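(* Let $k \geq 1$ be an integer, let $4 \mid N$, let $\psi$ be a Dirichlet character modulo $N$ with $\psi(-1)=1$, and let $f \in S_{k+\frac{1}{2}}(N,\psi)$ be a cusp form of weight $k+\frac12$, level $N$ and character $\psi$, with $q$-expansion $f(z)=\sum_{n\geq 1} a(n)q^n$ at the cusp $\infty$ (where $q=e^{2\pi i z}$). When $k=1$, assume moreover that $f$ lies in the subset $S^*_{3/2}(N,\psi)$ of forms whose Shimura lift is a cusp form. Let $d$ be a square-free positive integer and let $\psi_d$ be the character modulo $dN$ defined by $\psi_d(m)=\psi(m)\left(\frac{-1}{m}\right)^k\left(\frac{d}{m}\right)$. Assume: ( * ) $f$ is an eigenform for the Hecke operators $T(p^2)$ for all primes $p$ dividing $N$ but not dividing the conductor of $\psi_d$. If the block of coefficients $\{a(d), a(4d), a(9d), \dots, a(n^2 d), \dots\}$ is periodic as a function of $n$, then $a(n^2 d)=0$ for all $n \geq 1$.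
   Context: The quadratic residue symbol $\left(\frac{\cdot}{m}\right)$ is the one defined in Shimura's paper "On Modular Forms of Half Integral Weight" (Annals of Math. 97, 1973). $T(p^2)$ denotes the Hecke operator on half-integral weight forms. The Shimura lift referred to is Shimura's lifting of $f$ to an integral weight $2k$ modular form. *)

theory Defs
  imports "HOL-Analysis.Analysis" "HOL-Number_Theory.Number_Theory"
    "HOL-Computational_Algebra.Squarefree"
begin

section \<open>Characters and the quadratic residue symbol\<close>

definition dirichlet_character :: "nat \<Rightarrow> (int \<Rightarrow> complex) \<Rightarrow> bool" where
  "dirichlet_character N \<psi> \<longleftrightarrow>
     \<psi> 1 = 1 \<and>
     (\<forall>a b. \<psi> (a * b) = \<psi> a * \<psi> b) \<and>
     (\<forall>a b. [a = b] (mod int N) \<longrightarrow> \<psi> a = \<psi> b) \<and>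
     (\<forall>a. \<psi> a = 0 \<longleftrightarrow> \<not> coprime a (int N))"

definition conductor :: "nat \<Rightarrow> (int \<Rightarrow> complex) \<Rightarrow> nat" where
  "conductor N \<psi> =
     (LEAST c. c > 0 \<and> c dvd N \<and>
        (\<forall>a. coprime a (int N) \<and> [a = 1] (mod int c) \<longrightarrow> \<psi> a = 1))"

text \<open>
  Shimura's symbol \<open>(c/d)\<close> for odd \<open>d\<close> of either sign. For \<open>d > 0\<close> it is the Jacobi symbol;
  moreover \<open>(c/-1) = -1\<close> if \<open>c < 0\<close>, \<open>(c/-1) = 1\<close> if \<open>c > 0\<close>, and \<open>(0/1) = (0/-1) = 1\<close>.
  Shimura leaves the symbol undefined for even \<open>d\<close>; the value \<open>0\<close> chosen here never matters, as
  the symbol then only occurs multiplied by \<open>\<psi> m = 0\<close> with \<open>\<psi>\<close> of modulus divisible by 4.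
\<close>
definition quad_symbol :: "int \<Rightarrow> int \<Rightarrow> int" where
  "quad_symbol c d =
     (if even d then 0
      else (if c < 0 \<and> d < 0 then -1 else 1) * (\<Prod>p\<in>#prime_factorization d. Legendre c p))"

definition twisted_character :: "nat \<Rightarrow> (int \<Rightarrow> complex) \<Rightarrow> nat \<Rightarrow> int \<Rightarrow> complex" where
  "twisted_character k \<psi> t m =
     \<psi> m * of_int (quad_symbol (-1) m) ^ k * of_int (quad_symbol (int t) m)"


section \<open>Cusp forms of integral and half-integral weight\<close>

text \<open>Only the values of a form on the upper half plane are relevant.\<close>

definition upper_half_plane :: "complex set" where
  "upper_half_plane = {z. Im z > 0}"

definition moebius :: "int \<Rightarrow> int \<Rightarrow> int \<Rightarrow> int \<Rightarrow> complex \<Rightarrow> complex" where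
  "moebius a b c d z = (of_int a * z + of_int b) / (of_int c * z + of_int d)"

text \<open>
  \<open>J c d z\<close> is \<open>(c z + d)\<close> to the weight. Vanishing at the cusp \<open>\<gamma> \<infinity>\<close>, \<open>\<gamma> \<in> SL\<^sub>2(\<int>)\<close>, means that
  \<open>f\<close> slashed with \<open>\<gamma>\<close> has a Fourier expansion with positive exponents only. In half-integral
  weight the exponents at an irregular cusp have the form \<open>(n + r)/h\<close> with \<open>r\<close> rational, which is
  covered by enlarging \<open>h\<close>.
\<close>
definition vanishes_at_cusps ::
    "(int \<Rightarrow> int \<Rightarrow> complex \<Rightarrow> complex) \<Rightarrow> (complex \<Rightarrow> complex) \<Rightarrow> bool" where
  "vanishes_at_cusps J f \<longleftrightarrow>
     (\<forall>a b c d. a * d - b * c = 1 \<longrightarrow>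
        (\<exists>h C. h > (0::nat) \<and>
           (\<forall>z\<in>upper_half_plane.
              ((\<lambda>n::nat. C n * exp (2 * of_real pi * \<i> * of_nat n * z / of_nat h))
                 has_sum (f (moebius a b c d z) / J c d z)) {1..})))"

definition cusp_form_int :: "nat \<Rightarrow> nat \<Rightarrow> (int \<Rightarrow> complex) \<Rightarrow> (complex \<Rightarrow> complex) set" where
  "cusp_form_int w N \<psi> =
     {f. f holomorphic_on upper_half_plane \<and>
         (\<forall>a b c d. a * d - b * c = 1 \<and> int N dvd c \<longrightarrow>
            (\<forall>z\<in>upper_half_plane.
               f (moebius a b c d z) = \<psi> d * (of_int c * z + of_int d) ^ w * f z)) \<and>
         vanishes_at_cusps (\<lambda>c d z. (of_int c * z + of_int d) ^ w) f}"

definition theta_eps :: "int \<Rightarrow> complex" where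
  "theta_eps d = (if [d = 1] (mod 4) then 1 else \<i>)"

text \<open>
  The factor \<open>\<theta>(\<gamma> z) / \<theta>(z)\<close> for \<open>\<gamma> \<in> \<Gamma>\<^sub>0(4)\<close> with lower row \<open>(c, d)\<close>, where
  \<open>\<theta>(z) = \<Sum>\<^bsub>n\<in>\<int>\<^esub> exp (2\<pi>i n\<^sup>2 z)\<close>. The branch of \<open>csqrt\<close> (argument in \<open>]-\<pi>/2, \<pi>/2]\<close>) is Shimura's.
\<close>
definition theta_factor :: "int \<Rightarrow> int \<Rightarrow> complex \<Rightarrow> complex" where
  "theta_factor c d z =
     inverse (theta_eps d) * of_int (quad_symbol c d) * csqrt (of_int c * z + of_int d)"

text \<open>\<open>cusp_form_half k N \<psi>\<close> is \<open>S\<^bsub>k+1/2\<^esub>(N, \<psi>)\<close>, for \<open>4\<close> dividing \<open>N\<close>.\<close>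

definition cusp_form_half :: "nat \<Rightarrow> nat \<Rightarrow> (int \<Rightarrow> complex) \<Rightarrow> (complex \<Rightarrow> complex) set" where
  "cusp_form_half k N \<psi> =
     {f. f holomorphic_on upper_half_plane \<and>
         (\<forall>a b c d. a * d - b * c = 1 \<and> int N dvd c \<longrightarrow>
            (\<forall>z\<in>upper_half_plane.
               f (moebius a b c d z) = \<psi> d * theta_factor c d z ^ (2 * k + 1) * f z)) \<and>
         vanishes_at_cusps (\<lambda>c d z. csqrt (of_int c * z + of_int d) ^ (2 * k + 1)) f}"


section \<open>Fourier coefficients, Hecke operators and the Shimura lift\<close>

definition qpar :: "complex \<Rightarrow> complex" where
  "qpar z = exp (2 * of_real pi * \<i> * z)"

definition has_q_expansion :: "(complex \<Rightarrow> complex) \<Rightarrow> (nat \<Rightarrow> complex) \<Rightarrow> bool" where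
  "has_q_expansion f a \<longleftrightarrow>
     (\<forall>z\<in>upper_half_plane. ((\<lambda>n. a n * qpar z ^ n) has_sum f z) UNIV)"

definition q_coeff :: "(complex \<Rightarrow> complex) \<Rightarrow> nat \<Rightarrow> complex" where
  "q_coeff f = (THE a. has_q_expansion f a)"

definition q_series :: "(nat \<Rightarrow> complex) \<Rightarrow> complex \<Rightarrow> complex" where
  "q_series a z = (\<Sum>\<^sub>\<infinity>n\<in>{1..}. a n * qpar z ^ n)"

lemma has_q_expansion_unique:
  assumes "has_q_expansion f a" "has_q_expansion f b"
  shows "a = b"
proof -
  have *: "\<exists>z\<in>upper_half_plane. qpar z = w" if w: "w \<noteq> 0" "norm w < 1" for w
  proof
    show "Ln w / (2 * of_real pi * \<i>) \<in> upper_half_plane"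
      using w by (simp add: upper_half_plane_def Im_divide power2_eq_square divide_neg_pos)
    show "qpar (Ln w / (2 * of_real pi * \<i>)) = w"
      using w by (simp add: qpar_def)
  qed
  have sums: "(\<lambda>n. (a n - b n) * w ^ n) sums 0" if w: "w \<noteq> 0" "norm w < 1" for w
  proof -
    obtain z where z: "z \<in> upper_half_plane" "qpar z = w"
      using *[OF w] by blast
    have "(\<lambda>n. a n * w ^ n) sums f z" "(\<lambda>n. b n * w ^ n) sums f z"
      using assms z by (auto simp: has_q_expansion_def intro!: has_sum_imp_sums)
    then have "(\<lambda>n. a n * w ^ n - b n * w ^ n) sums (f z - f z)"
      by (rule sums_diff)
    then show ?thesis
      by (simp add: algebra_simps)
  qed
  have "a n - b n = 0" for n
  proof (induction n rule: less_induct)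
    case (less n)
    have "(\<lambda>m. (a (m + n) - b (m + n)) * w ^ m) sums 0" if "w \<noteq> 0" "norm w < 1" for w
    proof -
      have "(\<lambda>m. (a (m + n) - b (m + n)) * w ^ (m + n)) sums (0 - (\<Sum>i<n. (a i - b i) * w ^ i))"
        using sums_split_initial_segment[OF sums[OF that]] by simp
      also have "(\<Sum>i<n. (a i - b i) * w ^ i) = 0"
        using less by (intro sum.neutral) auto
      finally have "(\<lambda>m. (a (m + n) - b (m + n)) * w ^ (m + n) / w ^ n) sums (0 / w ^ n)"
        by (intro sums_divide) simp
      then show ?thesis
        using that by (simp add: power_add)
    qed
    then have "((\<lambda>w. 0) \<longlongrightarrow> a (0 + n) - b (0 + n)) (at (0::complex))"
      by (rule powser_limit_0_strong[OF zero_less_one])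
    then show ?case
      by (simp add: tendsto_const_iff)
  qed
  then show ?thesis
    by auto
qed

lemma q_coeff_eq: "has_q_expansion f a \<Longrightarrow> q_coeff f = a"
  unfolding q_coeff_def using has_q_expansion_unique by blast

text \<open>
  The action of \<open>T(p\<^sup>2)\<close> on \<open>S\<^bsub>k+1/2\<^esub>(N, \<psi>)\<close>, given by its effect on Fourier coefficients. If \<open>p\<close>
  divides \<open>N\<close>, then \<open>\<psi> p = 0\<close> and the \<open>n\<close>-th coefficient of the image is \<open>a (p\<^sup>2 n)\<close>.
\<close>
definition hecke_Tp2 ::
    "nat \<Rightarrow> (int \<Rightarrow> complex) \<Rightarrow> nat \<Rightarrow> (complex \<Rightarrow> complex) \<Rightarrow> complex \<Rightarrow> complex" where
  "hecke_Tp2 k \<psi> p f =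
     (let a = q_coeff f in
      q_series (\<lambda>n.
        a (p\<^sup>2 * n)
        + \<psi> (int p) * of_int (quad_symbol (-1) (int p)) ^ k
            * of_int (quad_symbol (int n) (int p)) * of_nat p ^ (k - 1) * a n
        + \<psi> ((int p)\<^sup>2) * of_nat p ^ (2 * k - 1) * (if p\<^sup>2 dvd n then a (n div p\<^sup>2) else 0)))"

definition eigenform_Tp2 ::
    "nat \<Rightarrow> (int \<Rightarrow> complex) \<Rightarrow> nat \<Rightarrow> (complex \<Rightarrow> complex) \<Rightarrow> bool" where
  "eigenform_Tp2 k \<psi> p f \<longleftrightarrow> (\<exists>\<mu>. \<forall>z\<in>upper_half_plane. hecke_Tp2 k \<psi> p f z = \<mu> * f z)"

text \<open>
  The lift attached to a square-free \<open>t\<close> is \<open>\<Sum>\<^bsub>n\<ge>1\<^esub> A(n) q\<^sup>n\<close>, where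
  \<open>\<Sum> A(n) n\<^bsup>-s\<^esup> = L(s - k + 1, \<psi>\<^sub>t) \<Sum> a(t n\<^sup>2) n\<^bsup>-s\<^esup>\<close>.
\<close>
definition shimura_lift ::
    "nat \<Rightarrow> (int \<Rightarrow> complex) \<Rightarrow> nat \<Rightarrow> (complex \<Rightarrow> complex) \<Rightarrow> complex \<Rightarrow> complex" where
  "shimura_lift k \<psi> t f =
     q_series (\<lambda>n. \<Sum>m | m dvd n.
       twisted_character k \<psi> t (int m) * of_nat m ^ (k - 1) * q_coeff f (t * (n div m)\<^sup>2))"

text \<open>
  \<open>S\<^sup>*\<^bsub>3/2\<^esub>(N, \<psi>)\<close>. The level of the lifts is not prescribed; being a cusp form does not depend on it.
\<close>
definition cusp_form_three_half_star ::
    "nat \<Rightarrow> (int \<Rightarrow> complex) \<Rightarrow> (complex \<Rightarrow> complex) set" where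
  "cusp_form_three_half_star N \<psi> =
     {f \<in> cusp_form_half 1 N \<psi>.
        \<forall>t. squarefree t \<longrightarrow>
          (\<exists>M>0. N dvd M \<and> shimura_lift 1 \<psi> t f \<in> cusp_form_int 2 M (\<lambda>m. \<psi> m ^ 2))}"

end

theory Submission
  imports Defs "HOL-Complex_Analysis.Complex_Analysis"
    "HOL-Computational_Algebra.Fundamental_Theorem_Algebra"
begin

text \<open>
  Fix a prime \<open>p \<ge> 5\<close> not dividing \<open>N d\<close>, and let \<open>T\<close> be the trace from \<open>\<Gamma>\<^sub>0(N p\<^sup>2)\<close> to \<open>\<Gamma>\<^sub>0(N)\<close> of
  \<open>f(p\<^sup>2 z)\<close>; up to a scalar this is \<open>T(p\<^sup>2)\<close>, and it preserves the cusp forms of level \<open>N\<close>. That space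
  is finite-dimensional, so \<open>Q(T) f = 0\<close> for some polynomial \<open>Q \<noteq> 0\<close>. On the coefficients
  \<open>x\<^sub>j = a(m\<^sup>2 d p\<^sup>2\<^sup>j)\<close>, \<open>p\<close> not dividing \<open>m\<close>, the operator acts by
  \<open>(T x)\<^sub>j = x\<^sub>j\<^sub>-\<^sub>1 + e\<^sub>j x\<^sub>j + D x\<^sub>j\<^sub>+\<^sub>1\<close> with \<open>\<bar>D\<bar> = p\<^sup>1\<^sup>-\<^sup>2\<^sup>k\<close> and small \<open>e\<^sub>j\<close>. An eigenvector of this
  recursion with \<open>x\<^sub>0 \<noteq> 0\<close> has a characteristic root of modulus greater than \<open>1\<close> and is unbounded, so
  \<open>T - \<mu>\<close> is injective on bounded sequences for every \<open>\<mu>\<close>. Hence \<open>Q(T) x = 0\<close> forces \<open>x = 0\<close> as soon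
  as \<open>x\<close> is bounded, in particular if the block \<open>a(n\<^sup>2 d)\<close> is periodic.

  The exact value of the Gauss sums \<open>e\<^sub>j\<close> is irrelevant, a trivial estimate suffices.
\<close>

text \<open>Finite dimension comes from a contraction. With y = Im z, |g| y^(weight/2) is invariant
  under \<open>Gamma0 N\<close>, and every point is equivalent to some \<sigma> w with Im w >= 1/5
  and \<sigma> from a finite list. In the coordinate q = exp(2 pi i w / N), enough prescribed zeros
  near q = 0 push the values on Im w >= 1/5 below a quarter of the supremum, so a form with these
  zeros is 0. The dependence of f, T f, T^2 f, ... is then linear algebra on values at finitely many
  points. The delicate point of the recursion is a solution that follows the smaller characteristic
  root, for growth alone does not exclude it. The equation at the bottom of the tower would force
  the larger root to be (e - e') / D, where e and e' are the diagonal entries at the bottom and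
  above it, while that root has modulus at least 1/|D|. Hence the condition |e - e'| < 1. The
  trivial estimate gives |e - e'| < 2 / sqrt p, which is where p >= 5 comes from.\<close>

hide_const (open) up_ring.coeff up_ring.monom

section \<open>Tridiagonal operators on bounded sequences\<close>

text \<open>More vectors than coordinates are dependent: one point is eliminated at a time, with a
  pivot \<open>s\<close>. Later the vectors are forms and the coordinates are their values on a
  finite set.\<close>

lemma nontrivial_vanishing_combination:
  fixes F :: "'i \<Rightarrow> 'a \<Rightarrow> 'b::field"
  assumes "finite E" "finite I" "card E < card I"
  shows "\<exists>c. (\<exists>i\<in>I. c i \<noteq> 0) \<and> (\<forall>e\<in>E. (\<Sum>i\<in>I. c i * F i e) = 0)"
  using assms
proof (induction E arbitrary: I F rule: finite_induct)
  case empty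
  then have "I \<noteq> {}" by auto
  then show ?case by (intro exI[of _ "\<lambda>_. 1"]) auto
next
  case (insert e E)
  show ?case
  proof (cases "\<forall>i\<in>I. F i e = 0")
    case True
    have "card E < card I" using insert by simp
    then show ?thesis
      using insert.IH[of I F] insert.prems True by auto
  next
    case False
    then obtain s where s: "s \<in> I" "F s e \<noteq> 0" by blast
    define F' where "F' = (\<lambda>i x. F i x - F i e / F s e * F s x)"
    have "card E < card (I - {s})" using insert s by simp
    then obtain c where c: "\<exists>i\<in>I - {s}. c i \<noteq> 0"
        "\<forall>x\<in>E. (\<Sum>i\<in>I - {s}. c i * F' i x) = 0"
      using insert.IH[of "I - {s}" F'] insert.prems by auto
    \<comment> \<open>The value at \<open>s\<close> collects the corrections made in
      \<open>F'\<close>, so both combinations agree at every point; at \<open>e\<close> every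
      \<open>F' i\<close> vanishes.\<close>
    define c' where "c' = c(s := - (\<Sum>i\<in>I - {s}. c i * F i e / F s e))"
    have *: "(\<Sum>i\<in>I. c' i * F i x) = (\<Sum>i\<in>I - {s}. c i * F' i x)" for x
    proof -
      have "(\<Sum>i\<in>I. c' i * F i x) = c' s * F s x + (\<Sum>i\<in>I - {s}. c' i * F i x)"
        using s insert.prems by (subst sum.remove[of I s]) auto
      also have "(\<Sum>i\<in>I - {s}. c' i * F i x) = (\<Sum>i\<in>I - {s}. c i * F i x)"
        by (intro sum.cong) (auto simp: c'_def)
      also have "c' s = - (\<Sum>i\<in>I - {s}. c i * F i e / F s e)"
        by (simp add: c'_def)
      finally show ?thesis
        by (simp add: F'_def sum_distrib_right sum_subtractf right_diff_distrib mult.assoc)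
    qed
    have "(\<Sum>i\<in>I - {s}. c i * F' i e) = 0"
      using s by (simp add: F'_def)
    then have "\<forall>x\<in>insert e E. (\<Sum>i\<in>I. c' i * F i x) = 0"
      using c(2) by (simp add: *)
    moreover have "\<exists>i\<in>I. c' i \<noteq> 0" using c(1) by (auto simp: c'_def)
    ultimately show ?thesis by blast
  qed
qed

section \<open>Bounded eigenvectors of the tridiagonal recursion\<close>

lemma geometric_bounded_eq_0:
  fixes y :: "nat \<Rightarrow> complex"
  assumes rec: "\<And>j. y (Suc j) = \<alpha> * y j" and "norm \<alpha> > 1" and bd: "\<And>j. norm (y j) \<le> B"
  shows "y j = 0"
proof -
  have y: "y j = \<alpha> ^ j * y 0" for j
    by (induction j) (auto simp: rec)
  have "y 0 = 0"
  proof (rule ccontr)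
    assume "y 0 \<noteq> 0"
    then obtain j where "B / norm (y 0) < norm \<alpha> ^ j"
      using real_arch_pow[OF assms(2)] by blast
    then have "B < norm (y j)"
      using \<open>y 0 \<noteq> 0\<close> by (subst y) (simp add: field_simps norm_mult norm_power)
    with bd[of j] show False by simp
  qed
  then show ?thesis using y[of j] by simp
qed

text \<open>The trace along a tower of indices \<open>n0 * (p^2) ^ j\<close>. The bottom diagonal
  entry is separate because the exponential sum on the diagonal is only known to be constant on
  multiples of \<open>p\<close>.\<close>

definition tridiag :: "complex \<Rightarrow> complex \<Rightarrow> complex \<Rightarrow> (nat \<Rightarrow> complex) \<Rightarrow> nat \<Rightarrow> complex" where
  "tridiag e e' D x j =
     (case j of 0 \<Rightarrow> e * x 0 + D * x 1 | Suc i \<Rightarrow> x i + e' * x (Suc i) + D * x (Suc (Suc i)))"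

lemma complex_quadratic_roots:
  fixes s m :: complex
  obtains \<alpha> \<beta> where "\<alpha> + \<beta> = s" "\<alpha> * \<beta> = m" "norm \<beta> \<le> norm \<alpha>"
proof -
  define r where "r = csqrt (s\<^sup>2 - 4 * m)"
  have r: "r * r = s\<^sup>2 - 4 * m" by (metis power2_csqrt power2_eq_square r_def)
  have sum: "(s + r) / 2 + (s - r) / 2 = s" by (simp add: field_simps)
  have prod: "(s + r) / 2 * ((s - r) / 2) = m"
    using r by (simp add: field_simps power2_eq_square)
  show ?thesis
    using that[OF sum prod] that[of "(s - r) / 2" "(s + r) / 2"] sum prod
    by (metis add.commute linorder_linear mult.commute)
qed

text \<open>The characteristic roots have product 1/D, so the larger one, \<open>\<alpha>\<close>,
  exceeds 1 in modulus. Since \<open>x (Suc j) - \<beta> * x j\<close> is multiplied by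
  \<open>\<alpha>\<close> at each step, boundedness makes it 0 and \<open>x\<close> is geometric
  with ratio \<open>\<beta>\<close>. If \<open>\<beta>\<close> has modulus above 1, growth finishes
  again; otherwise the equation at 0 decides.\<close>

lemma tridiag_bounded_eigenvector_eq_0:
  assumes D: "D \<noteq> 0" "norm D < 1" and e: "norm (e - e') < 1"
    and eig: "\<And>j. tridiag e e' D x j = \<mu> * x j"
    and bd: "\<And>j. norm (x j) \<le> B"
  shows "x j = 0"
proof -
  obtain \<alpha> \<beta> where ab: "\<alpha> + \<beta> = (\<mu> - e') / D" "\<alpha> * \<beta> = 1 / D" "norm \<beta> \<le> norm \<alpha>"
    using complex_quadratic_roots by blast
  have nab: "norm \<alpha> * norm \<beta> = 1 / norm D"
    by (metis ab(2) norm_divide norm_mult norm_one)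
  have "1 < norm \<alpha>"
  proof (rule ccontr)
    assume "\<not> 1 < norm \<alpha>"
    then have "norm \<alpha> * norm \<beta> \<le> 1 * 1" using ab(3) by (intro mult_mono) auto
    then show False using nab D by (simp add: field_simps)
  qed
  have rec: "x (Suc (Suc j)) = (\<alpha> + \<beta>) * x (Suc j) - \<alpha> * \<beta> * x j" for j
  proof -
    have "D * x (Suc (Suc j)) = (\<mu> - e') * x (Suc j) - x j"
      using eig[of "Suc j"] by (simp add: tridiag_def algebra_simps)
    then have "x (Suc (Suc j)) = ((\<mu> - e') * x (Suc j) - x j) / D"
      using D by (simp add: eq_divide_eq mult.commute)
    then show ?thesis by (simp add: ab diff_divide_distrib left_diff_distrib)
  qed
  have "x (Suc j) - \<beta> * x j = 0" for j
  proof (rule geometric_bounded_eq_0[where B = "B + norm \<beta> * B"])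
    show "x (Suc (Suc j)) - \<beta> * x (Suc j) = \<alpha> * (x (Suc j) - \<beta> * x j)" for j
      by (simp add: rec algebra_simps)
    show "norm (x (Suc j) - \<beta> * x j) \<le> B + norm \<beta> * B" for j
      using bd[of j] bd[of "Suc j"] norm_triangle_ineq4[of "x (Suc j)" "\<beta> * x j"]
        mult_left_mono[OF bd[of j], of "norm \<beta>"] by (simp add: norm_mult)
  qed fact
  then have x: "x (Suc j) = \<beta> * x j" for j by simp
  show ?thesis
  proof (cases "norm \<beta> > 1")
    case True
    show ?thesis by (rule geometric_bounded_eq_0[where y = x, OF x True bd])
  next
    case False
    have "x 0 = 0"
    proof (rule ccontr)
      assume "x 0 \<noteq> 0"
      moreover have "(e + D * \<beta>) * x 0 = \<mu> * x 0"
        using eig[of 0] x[of 0] by (simp add: tridiag_def algebra_simps)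
      ultimately have "\<mu> = e + D * \<beta>" by simp
      \<comment> \<open>The equation at 0 is combined with the sum of the roots. As
        \<open>\<beta>\<close> has modulus at most 1 here, \<open>norm \<alpha>\<close> is at least
        \<open>1 / norm D\<close>, a contradiction.\<close>
      then have "\<alpha> = (e - e') / D" using ab(1) D by (simp add: field_simps)
      then have "norm \<alpha> < 1 / norm D"
        using e D by (simp only: norm_divide) (simp add: divide_strict_right_mono)
      moreover have "norm \<alpha> * norm \<beta> \<le> norm \<alpha> * 1"
        using False by (intro mult_left_mono) auto
      ultimately show False using nab by simp
    qed
    moreover have "x j = \<beta> ^ j * x 0" by (induction j) (auto simp: x)
    ultimately show ?thesis by simp
  qed
qed

section \<open>Polynomials in a linear operator\<close>

definition poly_op ::
    "(('b \<Rightarrow> complex) \<Rightarrow> 'b \<Rightarrow> complex) \<Rightarrow> complex poly \<Rightarrow> ('b \<Rightarrow> complex) \<Rightarrow> 'b \<Rightarrow> complex" where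
  "poly_op T Q x j = (\<Sum>r\<le>degree Q. coeff Q r * (T ^^ r) x j)"

lemma poly_op_eq:
  assumes "degree Q \<le> n"
  shows "poly_op T Q x j = (\<Sum>r\<le>n. coeff Q r * (T ^^ r) x j)"
  unfolding poly_op_def using assms
  by (intro sum.mono_neutral_left) (auto simp: coeff_eq_0 not_le)

locale linear_operator =
  fixes T :: "('b \<Rightarrow> complex) \<Rightarrow> 'b \<Rightarrow> complex"
  assumes linear: "T (\<lambda>j. u * x j + y j) = (\<lambda>j. u * T x j + T y j)"
begin

lemma zero: "T (\<lambda>_. 0) = (\<lambda>_. 0)"
  using linear[of "-1" "\<lambda>_. 0" "\<lambda>_. 0"] by simp

lemma sum:
  "finite I \<Longrightarrow> T (\<lambda>j. \<Sum>i\<in>I. c i * x i j) = (\<lambda>j. \<Sum>i\<in>I. c i * T (x i) j)"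
  by (induction I rule: finite_induct) (auto simp: zero linear)

lemma poly_op_linear_factor:
  "poly_op T ([:-\<mu>, 1:] * Q) x j = T (poly_op T Q x) j - \<mu> * poly_op T Q x j"
proof -
  let ?n = "degree Q"
  have "degree ([:-\<mu>, 1:] * Q) \<le> Suc ?n"
    by (rule order.trans[OF degree_mult_le]) auto
  then have "poly_op T ([:-\<mu>, 1:] * Q) x j =
      (\<Sum>r\<le>Suc ?n. coeff ([:-\<mu>, 1:] * Q) r * (T ^^ r) x j)"
    by (rule poly_op_eq)
  also have "\<dots> = (\<Sum>r\<le>Suc ?n. coeff (pCons 0 Q) r * (T ^^ r) x j)
      - \<mu> * (\<Sum>r\<le>Suc ?n. coeff Q r * (T ^^ r) x j)"
    by (simp add: sum_distrib_left sum_subtractf algebra_simps)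
  also have "(\<Sum>r\<le>Suc ?n. coeff Q r * (T ^^ r) x j) = poly_op T Q x j"
    by (rule poly_op_eq[symmetric]) simp
  also have "(\<Sum>r\<le>Suc ?n. coeff (pCons 0 Q) r * (T ^^ r) x j)
      = (\<Sum>r\<le>?n. coeff Q r * (T ^^ Suc r) x j)"
    by (subst sum.atMost_Suc_shift) simp
  also have "\<dots> = T (poly_op T Q x) j"
    by (simp add: poly_op_def[abs_def] sum)
  finally show ?thesis .
qed

text \<open>Over the complex numbers \<open>Q\<close> has a factor X - \<mu>, and the cofactor
  applied to \<open>x\<close> is an eigenvector for \<mu>. The subspace \<open>S\<close> is carried
  along because eigenvectors are controlled only inside it; later it consists of the bounded
  sequences.\<close>

lemma poly_op_injective:
  assumes inv: "\<And>x. x \<in> S \<Longrightarrow> T x \<in> S"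
    and lin: "\<And>u x y. x \<in> S \<Longrightarrow> y \<in> S \<Longrightarrow> (\<lambda>j. u * x j + y j) \<in> S"
    and inj: "\<And>x \<mu>. x \<in> S \<Longrightarrow> (\<And>j. T x j = \<mu> * x j) \<Longrightarrow> x = (\<lambda>_. 0)"
    and "Q \<noteq> 0" "x \<in> S" "poly_op T Q x = (\<lambda>_. 0)"
  shows "x = (\<lambda>_. 0)"
  using \<open>Q \<noteq> 0\<close> \<open>poly_op T Q x = (\<lambda>_. 0)\<close>
proof (induction "degree Q" arbitrary: Q)
  case 0
  then obtain a where "Q = [:a:]" "a \<noteq> 0" by (metis degree_eq_zeroE pCons_eq_0_iff)
  then show ?case using 0 by (auto simp: poly_op_def fun_eq_iff)
next
  case (Suc n)
  have z: "(\<lambda>_. 0) \<in> S" using lin[OF \<open>x \<in> S\<close> \<open>x \<in> S\<close>, of "-1"] by simp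
  have pw: "(T ^^ r) x \<in> S" for r
    by (induction r) (auto simp: inv \<open>x \<in> S\<close>)
  have "(\<lambda>j. \<Sum>i\<in>I. c i * (T ^^ i) x j) \<in> S" if "finite I" for I c
    using that by (induction I rule: finite_induct) (auto simp: z lin pw)
  then have mem: "poly_op T R x \<in> S" for R
    by (auto simp: poly_op_def[abs_def])
  obtain \<mu> where "poly Q \<mu> = 0"
    using Suc(2) alg_closed_imp_poly_has_root[of Q] by auto
  then obtain R where R: "Q = [:-\<mu>, 1:] * R" by (metis dvdE poly_eq_0_iff_dvd)
  with Suc have "R \<noteq> 0" by auto
  then have "degree Q = Suc (degree R)" by (simp add: R degree_mult_eq del: mult_pCons_left)
  moreover have "poly_op T R x = (\<lambda>_. 0)"
  proof (rule inj[OF mem])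
    show "T (poly_op T R x) j = \<mu> * poly_op T R x j" for j
      using poly_op_linear_factor[of \<mu> R x j] Suc.prems(2) unfolding R by (auto simp: fun_eq_iff)
  qed
  ultimately show ?case using Suc \<open>R \<noteq> 0\<close> by auto
qed

end

lemma tridiag_annihilated_bounded_eq_0:
  assumes D: "D \<noteq> 0" "norm D < 1" and e: "norm (e - e') < 1"
    and bd: "\<And>j. norm (x j) \<le> B"
    and c: "r0 \<le> n" "c r0 \<noteq> 0" and ann: "\<And>j. (\<Sum>r\<le>n. c r * (tridiag e e' D ^^ r) x j) = 0"
  shows "x j = 0"
proof -
  interpret linear_operator "tridiag e e' D"
    by unfold_locales (auto simp: tridiag_def fun_eq_iff algebra_simps split: nat.splits)
  let ?S = "{x::nat \<Rightarrow> complex. \<exists>B. \<forall>j. norm (x j) \<le> B}"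
  \<comment> \<open>Only some \<open>c r0\<close> is known to be nonzero, not the top one, so
    \<open>Q\<close> may have degree smaller than \<open>n\<close>.\<close>
  define Q where "Q = (\<Sum>r\<le>n. monom (c r) r)"
  have coeff: "coeff Q i = (if i \<le> n then c i else 0)" for i
    by (simp add: Q_def coeff_sum sum.delta)
  have "x = (\<lambda>_. 0)"
  proof (rule poly_op_injective[of ?S Q])
    show lin: "(\<lambda>j. u * x j + y j) \<in> ?S" if "x \<in> ?S" "y \<in> ?S" for u x y
    proof -
      obtain A B where AB: "\<And>j. norm (x j) \<le> A" "\<And>j. norm (y j) \<le> B"
        using \<open>x \<in> ?S\<close> \<open>y \<in> ?S\<close> by auto
      have "norm (u * x j + y j) \<le> norm u * A + B" for j
        by (rule order.trans[OF norm_triangle_ineq])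
           (auto intro!: add_mono mult_left_mono AB simp: norm_mult)
      then show ?thesis by blast
    qed
    show "tridiag e e' D x \<in> ?S" if x: "x \<in> ?S" for x
    proof -
      obtain A where A: "\<And>j. norm (x j) \<le> A" using x by blast
      then have "0 \<le> A" by (meson norm_ge_zero order_trans)
      have "norm (tridiag e e' D x j) \<le> A + norm e * A + norm e' * A + norm D * A" for j
      proof -
        have A': "norm (u * x i) \<le> norm u * A" for u i
          by (simp add: norm_mult A mult_left_mono)
        have pos: "0 \<le> norm e * A" "0 \<le> norm e' * A" using \<open>0 \<le> A\<close> by auto
        show ?thesis
        proof (cases j)
          case 0
          then have eq: "tridiag e e' D x j = e * x 0 + D * x 1" by (simp add: tridiag_def)
          show ?thesis
            unfolding eq using A'[of e 0] A'[of D 1] norm_triangle_ineq[of "e * x 0" "D * x 1"] pos \<open>0 \<le> A\<close>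
            by linarith
        next
          case (Suc i)
          then have eq: "tridiag e e' D x j = x i + e' * x j + D * x (Suc j)"
            by (simp add: tridiag_def)
          show ?thesis
            unfolding eq using A[of i] A'[of e' j] A'[of D "Suc j"] norm_triangle_ineq[of "x i" "e' * x j"]
              norm_triangle_ineq[of "x i + e' * x j" "D * x (Suc j)"] pos by linarith
        qed
      qed
      then show ?thesis by blast
    qed
    show "x = (\<lambda>_. 0)" if x: "x \<in> ?S" and eig: "\<And>j. tridiag e e' D x j = \<mu> * x j" for x \<mu>
    proof
      obtain B where "\<And>j. norm (x j) \<le> B" using x by blast
      then show "x j = 0" for j by (rule tridiag_bounded_eigenvector_eq_0[OF D e eig])
    qed
    show "Q \<noteq> 0" using c coeff[of r0] by auto
    show "x \<in> ?S" using bd by blast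
    have "degree Q \<le> n" by (rule degree_le) (auto simp: coeff)
    then show "poly_op (tridiag e e' D) Q x = (\<lambda>_. 0)"
      using ann by (auto simp: fun_eq_iff poly_op_eq coeff)
  qed
  then show ?thesis by simp
qed

section \<open>Periodic holomorphic functions on the upper half plane\<close>

lemma sqrt_power_exp_bounded:
  assumes "c > 0"
  obtains C :: real where "C > 0" "\<And>y. y > 0 \<Longrightarrow> sqrt y ^ W * exp (- c * y) \<le> C"
proof -
  \<comment> \<open>\<open>\<epsilon>\<close> at most 1 gives \<epsilon> (1 + y) <= exp(\<epsilon>
    y), and \<epsilon> W <= c lets exp(c y) absorb the W-th power.\<close>
  define \<epsilon> where "\<epsilon> = min 1 (c / (W + 1))"
  have \<epsilon>: "\<epsilon> > 0" "\<epsilon> \<le> 1" "\<epsilon> * (W + 1) \<le> c"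
  proof -
    have "\<epsilon> * (W + 1) \<le> c / (W + 1) * (W + 1)"
      by (intro mult_right_mono) (auto simp: \<epsilon>_def)
    then show "\<epsilon> * (W + 1) \<le> c" by simp
  qed (use assms in \<open>auto simp: \<epsilon>_def\<close>)
  have "sqrt y ^ W * exp (- c * y) \<le> (1 / \<epsilon>) ^ W" if "y > 0" for y
  proof -
    have "sqrt y \<le> 1 + y"
      using that by (intro real_le_lsqrt) (auto simp: power2_eq_square algebra_simps)
    also have "\<dots> \<le> 1 / \<epsilon> * exp (\<epsilon> * y)"
    proof -
      have "\<epsilon> * (1 + y) \<le> exp (\<epsilon> * y)"
        using exp_ge_add_one_self[of "\<epsilon> * y"] \<epsilon> unfolding distrib_left by linarith
      then show ?thesis using \<epsilon> by (simp add: field_simps)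
    qed
    finally have "sqrt y ^ W \<le> (1 / \<epsilon> * exp (\<epsilon> * y)) ^ W"
      using that by (intro power_mono) auto
    also have "\<dots> = (1 / \<epsilon>) ^ W * exp (real W * (\<epsilon> * y))"
      by (simp only: power_mult_distrib exp_of_nat_mult)
    also have "\<dots> \<le> (1 / \<epsilon>) ^ W * exp (c * y)"
    proof -
      have "(W * \<epsilon>) * y \<le> c * y"
        using \<epsilon> that by (intro mult_right_mono) (auto simp: algebra_simps)
      then show ?thesis using \<epsilon> by (intro mult_left_mono) (auto simp: algebra_simps)
    qed
    finally show ?thesis
      by (simp add: exp_minus field_simps)
  qed
  then show ?thesis using \<epsilon> by (intro that[of "(1 / \<epsilon>) ^ W"]) auto
qed

text \<open>Zeros are divided out one at a time. The next zero \<open>a\<close> differs from the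
  earlier ones, so it is a zero of the quotient \<open>K\<close>, whose difference quotient at
  \<open>a\<close> has a removable singularity.\<close>

lemma holomorphic_factor_finite_zeros:
  assumes "finite Z" "open S" "Z \<subseteq> S" "H holomorphic_on S" "\<And>a. a \<in> Z \<Longrightarrow> H a = 0"
  shows "\<exists>K. K holomorphic_on S \<and> (\<forall>q\<in>S. H q = (\<Prod>a\<in>Z. q - a) * K q)"
  using assms
proof (induction Z rule: finite_induct)
  case empty
  then show ?case by (intro exI[of _ H]) auto
next
  case (insert a Z)
  then obtain K where K: "K holomorphic_on S" "\<And>q. q \<in> S \<Longrightarrow> H q = (\<Prod>a\<in>Z. q - a) * K q"
    by auto
  have "(\<Prod>b\<in>Z. a - b) \<noteq> 0" using insert.hyps by auto
  moreover have "(\<Prod>b\<in>Z. a - b) * K a = 0"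
    using K(2)[of a] insert.prems by auto
  ultimately have Ka: "K a = 0" by simp
  define K' where "K' = (\<lambda>z. if z = a then deriv K a else (K z - K a) / (z - a))"
  have "K' holomorphic_on S"
    unfolding K'_def by (rule pole_lemma_open) (use K insert in auto)
  moreover have "K q = (q - a) * K' q" for q
    by (auto simp: K'_def Ka)
  ultimately show ?case
    using insert.hyps K(2) by (intro exI[of _ K']) (auto simp: mult_ac)
qed

text \<open>A Schwarz lemma with several zeros: the maximum principle is applied to \<open>H\<close>
  divided by its known zeros. Each zero in \<open>Z\<close> contributes
  \<open>(r + s) / (R - s)\<close>. The zero at 0 is kept as \<open>norm q\<close>, whose decay
  towards the cusp later compensates the growth of \<open>sqrt (Im w) ^ W\<close>.\<close>

lemma norm_le_of_many_zeros:
  fixes H :: "complex \<Rightarrow> complex"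
  assumes H: "H holomorphic_on ball 0 1" "H 0 = 0"
    and Z: "finite Z" "0 \<notin> Z" "Z \<subseteq> cball 0 s" "\<And>a. a \<in> Z \<Longrightarrow> H a = 0"
    and r: "0 \<le> s" "0 \<le> r" "r < R" "s < R" "R < 1"
    and B: "\<And>u. norm u = R \<Longrightarrow> norm (H u) \<le> B" and q: "norm q \<le> r"
  shows "norm (H q) \<le> B * (norm q / (R - s)) * ((r + s) / (R - s)) ^ card Z"
proof -
  have "0 \<le> B"
    using B[of "of_real R"] r by (metis abs_of_nonneg less_eq_real_def norm_ge_zero norm_of_real order_trans)
  have "insert 0 Z \<subseteq> ball 0 1" using Z r by auto
  then have "\<exists>K. K holomorphic_on ball 0 1 \<and>
      (\<forall>q\<in>ball 0 1. H q = (\<Prod>a\<in>insert 0 Z. q - a) * K q)"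
    by (intro holomorphic_factor_finite_zeros) (use H Z in auto)
  then obtain K where K: "K holomorphic_on ball 0 1"
      "\<And>q. q \<in> ball 0 1 \<Longrightarrow> H q = (\<Prod>a\<in>insert 0 Z. q - a) * K q"
    by blast
  have "norm (K q) \<le> B / (R - s) ^ Suc (card Z)"
  proof (rule maximum_modulus_frontier[of K "cball 0 R"])
    show "K holomorphic_on interior (cball 0 R)" "continuous_on (closure (cball 0 R)) K"
      using K(1) r by (auto intro: holomorphic_on_subset continuous_on_subset holomorphic_on_imp_continuous_on)
    show "norm (K u) \<le> B / (R - s) ^ Suc (card Z)" if "u \<in> frontier (cball 0 R)" for u
    proof -
      have u: "norm u = R" using that r by simp
      have "(R - s) ^ Suc (card Z) = (\<Prod>a\<in>insert 0 Z. R - s)"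
        using Z by simp
      also have "\<dots> \<le> (\<Prod>a\<in>insert 0 Z. norm (u - a))"
      proof (rule prod_mono)
        fix a assume "a \<in> insert 0 Z"
        then have "norm a \<le> s" using Z r by auto
        then show "0 \<le> R - s \<and> R - s \<le> norm (u - a)"
          using u r norm_triangle_ineq2[of u a] by auto
      qed
      finally have "(R - s) ^ Suc (card Z) * norm (K u) \<le> (\<Prod>a\<in>insert 0 Z. norm (u - a)) * norm (K u)"
        by (rule mult_right_mono) simp
      also have "\<dots> = norm (H u)"
        using K(2)[of u] u r by (simp add: norm_mult prod_norm)
      also have "\<dots> \<le> B" using B u by simp
      finally show ?thesis using r by (subst pos_le_divide_eq) (auto simp: mult.commute)
    qed
  qed (use q r in auto)
  moreover have "(\<Prod>a\<in>insert 0 Z. norm (q - a)) \<le> norm q * (r + s) ^ card Z"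
  proof -
    have "(\<Prod>a\<in>Z. norm (q - a)) \<le> (\<Prod>a\<in>Z. r + s)"
    proof (rule prod_mono)
      fix a assume "a \<in> Z"
      then have "norm a \<le> s" using Z by auto
      then show "0 \<le> norm (q - a) \<and> norm (q - a) \<le> r + s"
        using q norm_triangle_ineq4[of q a] by auto
    qed
    then show ?thesis using Z by (auto intro!: mult_left_mono)
  qed
  moreover have "norm (H q) = (\<Prod>a\<in>insert 0 Z. norm (q - a)) * norm (K q)"
    using K(2)[of q] q r by (simp add: norm_mult prod_norm)
  ultimately have "norm (H q) \<le> (norm q * (r + s) ^ card Z) * (B / (R - s) ^ Suc (card Z))"
    using r by (simp only:) (intro mult_mono, auto)
  also have "\<dots> = B * (norm q / (R - s)) * ((r + s) / (R - s)) ^ card Z"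
    by (simp add: power_divide)
  finally show ?thesis .
qed

section \<open>From periodic functions on the half plane to functions on the disc\<close>

lemma periodic_int:
  assumes "\<And>w. w \<in> upper_half_plane \<Longrightarrow> G (w + of_real h) = G w" "w \<in> upper_half_plane"
  shows "G (w + of_int n * of_real h) = G w"
proof -
  have nat: "G (w + of_nat m * of_real h) = G w" if "w \<in> upper_half_plane" for m w
  proof (induction m)
    case (Suc m)
    have "w + of_nat m * of_real h \<in> upper_half_plane"
      using that by (auto simp: upper_half_plane_def)
    then have "G (w + of_nat m * of_real h + of_real h) = G (w + of_nat m * of_real h)"
      by (rule assms(1))
    then show ?case using Suc by (simp add: algebra_simps)
  qed simp
  show ?thesis
  proof (cases n)
    case (nonneg m)
    then show ?thesis using nat[OF assms(2), of m] by simp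
  next
    case (neg m)
    have "w + of_int n * of_real h \<in> upper_half_plane"
      using assms(2) by (auto simp: upper_half_plane_def)
    then have "G (w + of_int n * of_real h + of_nat (Suc m) * of_real h) = G (w + of_int n * of_real h)"
      by (rule nat)
    moreover have "w + of_int n * of_real h + of_nat (Suc m) * of_real h = w"
      by (simp add: neg algebra_simps)
    ultimately show ?thesis by metis
  qed
qed

lemma periodic_imp_disc_function:
  fixes G :: "complex \<Rightarrow> complex" and h :: real
  assumes hol: "G holomorphic_on upper_half_plane" and "h > 0"
    and per: "\<And>w. w \<in> upper_half_plane \<Longrightarrow> G (w + of_real h) = G w"
    and lim: "\<And>\<epsilon>. \<epsilon> > 0 \<Longrightarrow> \<exists>Y. \<forall>w. Im w > Y \<longrightarrow> norm (G w) < \<epsilon>"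
  obtains H where "H holomorphic_on ball 0 1" "H 0 = 0"
    "\<And>w. w \<in> upper_half_plane \<Longrightarrow> H (exp (2 * of_real pi * \<i> * w / of_real h)) = G w"
proof -
  define L where "L = (\<lambda>u. of_real h * u / (2 * of_real pi * \<i>))"
  define H where "H = (\<lambda>q. if q = 0 then 0 else G (L (Ln q)))"
  have ImL: "Im (L u) = - h * Re u / (2 * pi)" for u
    by (simp add: L_def Im_divide power2_eq_square field_simps)
  have Lupper: "L u \<in> upper_half_plane" if "norm (exp u) < 1" for u
    using that \<open>h > 0\<close> by (simp add: upper_half_plane_def ImL divide_neg_pos mult_pos_neg)
  have GL: "G (L u) = G (L v)" if "exp u = exp v" "norm (exp v) < 1" for u v
  proof -
    obtain n :: int where "u = v + of_int (2 * n) * of_real pi * \<i>"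
      using \<open>exp u = exp v\<close> by (auto simp: exp_eq)
    then have "L u = L v + of_int n * of_real h"
      by (simp add: L_def field_simps)
    then show ?thesis using periodic_int[where G = G and h = h, OF per Lupper[OF that(2)]] by simp
  qed
  have HG: "H (exp u) = G (L u)" if "norm (exp u) < 1" for u
    unfolding H_def using GL[of "Ln (exp u)" u] that by simp
  have "H holomorphic_on ball 0 1 - {0}"
  proof -
    have "H field_differentiable at q0" if q0: "q0 \<in> ball 0 1 - {0}" for q0
    proof -
      \<comment> \<open>On this ball |1 - q/q0| < 1, so q/q0 stays in the right half plane and
        \<open>Ln (q / q0) + Ln q0\<close> is a holomorphic logarithm even if \<open>q0\<close> lies
        on the cut of \<open>Ln\<close>.\<close>
      define U where "U = ball q0 (norm q0) \<inter> ball 0 1"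
      have U: "open U" "q0 \<in> U" using q0 by (auto simp: U_def)
      have Unz: "q / q0 \<notin> \<real>\<^sub>\<le>\<^sub>0 \<and> q \<noteq> 0" if "q \<in> U" for q
      proof -
        have "norm (1 - q / q0) < 1"
        proof -
          have "1 - q / q0 = (q0 - q) / q0" using q0 by (simp add: field_simps)
          then show ?thesis using that q0 by (simp add: U_def norm_divide dist_norm)
        qed
        then have "Re (1 - q / q0) < 1" using complex_Re_le_cmod[of "1 - q / q0"] by linarith
        then have "Re (q / q0) > 0" by simp
        then show ?thesis by (auto simp: complex_nonpos_Reals_iff)
      qed
      have "(\<lambda>q. G (L (Ln (q / q0) + Ln q0))) holomorphic_on U"
      proof (rule holomorphic_on_compose_gen[OF _ hol, unfolded o_def])
        show "(\<lambda>q. L (Ln (q / q0) + Ln q0)) holomorphic_on U"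
          unfolding L_def using Unz q0 by (auto intro!: holomorphic_intros)
        show "(\<lambda>q. L (Ln (q / q0) + Ln q0)) ` U \<subseteq> upper_half_plane"
          using Unz q0 by (auto intro!: Lupper simp: exp_add U_def)
      qed
      moreover have "H q = G (L (Ln (q / q0) + Ln q0))" if "q \<in> U" for q
        using HG[of "Ln (q / q0) + Ln q0"] Unz[OF that] q0 that by (simp add: exp_add U_def)
      ultimately have "H holomorphic_on U"
        by (metis (no_types, lifting) holomorphic_cong)
      then show ?thesis using U holomorphic_on_imp_differentiable_at by blast
    qed
    then show ?thesis
      by (simp add: holomorphic_on_def field_differentiable_at_within)
  qed
  moreover have "(H \<longlongrightarrow> H 0) (at 0 within ball 0 1)"
  proof (rule tendstoI)
    fix \<epsilon> :: real assume "\<epsilon> > 0"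
    then obtain Y where Y: "\<And>w. Im w > Y \<Longrightarrow> norm (G w) < \<epsilon>" using lim by blast
    \<comment> \<open>This radius is the modulus that corresponds to height
      \<open>Y\<close>.\<close>
    have "\<forall>\<^sub>F q in at 0 within ball 0 1. q \<in> ball 0 (exp (- 2 * pi * Y / h))"
      by (auto simp: eventually_at dist_commute intro!: exI[of _ "exp (- 2 * pi * Y / h)"])
    then show "\<forall>\<^sub>F q in at 0 within ball 0 1. dist (H q) (H 0) < \<epsilon>"
    proof (eventually_elim)
      case (elim q)
      show ?case
      proof (cases "q = 0")
        case False
        then have "ln (norm q) < ln (exp (- 2 * pi * Y / h))"
          using elim by (subst ln_less_cancel_iff) auto
        then have "Y < Im (L (Ln q))" using False \<open>h > 0\<close> by (simp add: ImL field_simps)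
        then show ?thesis using Y False by (simp add: H_def dist_norm)
      qed (simp add: \<open>\<epsilon> > 0\<close>)
    qed
  qed
  ultimately have "H holomorphic_on ball 0 1"
    using no_isolated_singularity'[of "{0}" H "ball 0 1"] by simp
  moreover have "H 0 = 0" by (simp add: H_def)
  moreover have "H (exp (2 * of_real pi * \<i> * w / of_real h)) = G w" if "w \<in> upper_half_plane" for w
    using HG[of "2 * of_real pi * \<i> * w / of_real h"] that \<open>h > 0\<close>
    by (simp add: L_def upper_half_plane_def divide_neg_pos mult_neg_pos)
  ultimately show ?thesis by (rule that)
qed

lemma norm_exp_period:
  "norm (exp (2 * of_real pi * \<i> * w / of_real h)) = exp (- (2 * pi / h) * Im w)"
  by simp

text \<open>
  The points are taken so high in the half plane that, in the coordinate \<open>q\<close>, they are much closer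
  to \<open>0\<close> than the circle on which the maximum principle is applied.
\<close>
lemma periodic_small_of_vanishing:
  fixes h c0 :: real and W :: nat
  assumes "h > 0" "W > 0" "c0 > 0"
  obtains P where "finite P" "P \<subseteq> upper_half_plane"
    "\<And>G S w. \<lbrakk>G holomorphic_on upper_half_plane;
        \<And>w. w \<in> upper_half_plane \<Longrightarrow> G (w + of_real h) = G w;
        \<And>w. w \<in> upper_half_plane \<Longrightarrow> norm (G w) * sqrt (Im w) ^ W \<le> S;
        \<And>w. w \<in> P \<Longrightarrow> G w = 0; Im w \<ge> c0\<rbrakk> \<Longrightarrow> norm (G w) * sqrt (Im w) ^ W \<le> S / 16"
proof -
  define q where "q = (\<lambda>w. exp (2 * of_real pi * \<i> * w / of_real h))"
  have nq: "norm (q w) = exp (- (2 * pi / h) * Im w)" for w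
    unfolding q_def by (rule norm_exp_period)
  \<comment> \<open>\<open>r\<close> and \<open>R\<close> are the moduli of \<open>q\<close> on the
    lines Im w = c0 and Im w = c0 / 2. Taking for \<open>s\<close> a quarter of their distance makes
    the gain \<open>\<rho>\<close> per zero smaller than 1.\<close>
  define r where "r = exp (- (2 * pi / h) * c0)"
  define R where "R = exp (- (2 * pi / h) * (c0 / 2))"
  have rR: "0 < r" "r < R" "R < 1"
  proof -
    have "pi * c0 / h > 0" using assms by simp
    then show "r < R" by (simp add: r_def R_def)
  qed (use assms in \<open>auto simp: r_def R_def\<close>)
  define s where "s = (R - r) / 4"
  have s: "0 < s" "s < R" "r + s < R - s" using rR by (auto simp: s_def field_simps)
  define \<rho> where "\<rho> = (r + s) / (R - s)"
  have \<rho>: "0 < \<rho>" "\<rho> < 1" using s rR by (auto simp: \<rho>_def)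
  obtain C where C: "C > 0" "\<And>y. y > 0 \<Longrightarrow> sqrt y ^ W * exp (- (2 * pi / h) * y) \<le> C"
    using sqrt_power_exp_bounded[of "2 * pi / h" W] assms by auto
  define A where "A = C / ((R - s) * sqrt (c0 / 2) ^ W)"
  have A: "A > 0" using C s assms by (simp add: A_def)
  \<comment> \<open>\<open>A\<close> collects all losses of the estimate, and \<open>M\<close> zeros
    outweigh them by a factor 16. The functions fed in later are squares of forms, for which this
    means a factor 4.\<close>
  obtain M where M: "\<rho> ^ M < 1 / (16 * A)"
    using real_arch_pow_inv[of "1 / (16 * A)" \<rho>] A \<rho> by auto
  define Y where "Y = max 1 (- ln s * h / (2 * pi))"
  have Y: "Y > 0" "exp (- (2 * pi / h) * Y) \<le> s"
  proof -
    have "- (2 * pi / h) * Y \<le> - (2 * pi / h) * (- ln s * h / (2 * pi))"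
      using assms by (intro mult_left_mono_neg) (auto simp: Y_def)
    also have "\<dots> = ln s" using assms by simp
    finally show "exp (- (2 * pi / h) * Y) \<le> s"
      using s by (metis exp_le_cancel_iff exp_ln)
  qed (simp add: Y_def)
  \<comment> \<open>Different heights give different moduli of \<open>q\<close>, hence
    \<open>M\<close> distinct zeros; heights from \<open>Y\<close> upwards put them in the disc of
    radius \<open>s\<close>.\<close>
  define P where "P = (\<lambda>j. \<i> * of_real (Y + real j)) ` {..<M}"
  show ?thesis
  proof (rule that[of P])
    show "finite P" by (simp add: P_def)
    show "P \<subseteq> upper_half_plane" using Y by (auto simp: P_def upper_half_plane_def)
    fix G S w
    assume hol: "G holomorphic_on upper_half_plane"
      and per: "\<And>w. w \<in> upper_half_plane \<Longrightarrow> G (w + of_real h) = G w"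
      and bd: "\<And>w. w \<in> upper_half_plane \<Longrightarrow> norm (G w) * sqrt (Im w) ^ W \<le> S"
      and P0: "\<And>w. w \<in> P \<Longrightarrow> G w = 0" and w: "Im w \<ge> c0"
    have Im_w: "Im w > 0" using w assms by simp
    have S0: "S \<ge> 0"
      using bd[of \<i>] by (simp add: upper_half_plane_def) (meson norm_ge_zero order_trans)
    \<comment> \<open>The weighted bound by \<open>S\<close> already forces decay at the cusp, since
      \<open>sqrt (Im w) ^ W\<close> tends to infinity.\<close>
    have lim: "\<exists>Y. \<forall>w. Im w > Y \<longrightarrow> norm (G w) < \<epsilon>" if "\<epsilon> > 0" for \<epsilon>
    proof (intro exI allI impI)
      fix w assume w: "Im w > max 1 ((S / \<epsilon>)\<^sup>2)"
      then have "w \<in> upper_half_plane" by (simp add: upper_half_plane_def)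
      have "S / \<epsilon> < sqrt (Im w)" using w by (intro real_less_rsqrt) simp
      also have "\<dots> \<le> sqrt (Im w) ^ W"
        using w \<open>W > 0\<close> by (intro self_le_power) auto
      finally have "S < \<epsilon> * sqrt (Im w) ^ W" using that by (simp add: field_simps)
      with bd[OF \<open>w \<in> upper_half_plane\<close>]
      have "norm (G w) * sqrt (Im w) ^ W < \<epsilon> * sqrt (Im w) ^ W" by linarith
      then show "norm (G w) < \<epsilon>" using w by simp
    qed
    obtain H where H: "H holomorphic_on ball 0 1" "H 0 = 0"
        "\<And>w. w \<in> upper_half_plane \<Longrightarrow> H (q w) = G w"
      unfolding q_def using periodic_imp_disc_function[OF hol \<open>h > 0\<close> per lim] by metis
    define Z where "Z = q ` P"
    have inj: "inj_on (\<lambda>j. q (\<i> * of_real (Y + real j))) {..<M}"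
    proof (rule inj_onI)
      fix i j assume "q (\<i> * of_real (Y + real i)) = q (\<i> * of_real (Y + real j))"
      then have "exp (- (2 * pi / h) * (Y + real i)) = exp (- (2 * pi / h) * (Y + real j))"
        using nq[of "\<i> * of_real (Y + real i)"] nq[of "\<i> * of_real (Y + real j)"] by simp
      then show "i = j" using assms by simp
    qed
    have cardZ: "card Z = M"
      unfolding Z_def P_def image_image using card_image[OF inj] by simp
    have "norm (H (q w)) \<le> S / sqrt (c0 / 2) ^ W * (norm (q w) / (R - s)) * ((r + s) / (R - s)) ^ card Z"
    proof (rule norm_le_of_many_zeros[OF H(1,2)])
      show "finite Z" by (simp add: Z_def P_def)
      show "0 \<notin> Z" by (auto simp: Z_def q_def)
      show "Z \<subseteq> cball 0 s"
      proof -
        have "norm (q (\<i> * of_real (Y + real j))) \<le> s" for j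
        proof -
          have "exp (- (2 * pi / h) * (Y + real j)) \<le> exp (- (2 * pi / h) * Y)"
            using assms by (simp add: divide_right_mono)
          then have "exp (- (2 * pi / h) * (Y + real j)) \<le> s" using Y(2) by linarith
          then show ?thesis unfolding nq by simp
        qed
        then show ?thesis by (auto simp: Z_def P_def simp del: of_real_add)
      qed
      show "H a = 0" if "a \<in> Z" for a
        using that P0 H(3) \<open>P \<subseteq> upper_half_plane\<close> by (auto simp: Z_def)
      show "norm (H u) \<le> S / sqrt (c0 / 2) ^ W" if "norm u = R" for u
      proof -
        have "u \<noteq> 0" using that rR by auto
        \<comment> \<open>Every point of the circle of radius \<open>R\<close> comes from the line
          Im v = c0 / 2, where the bound by \<open>S\<close> is available.\<close>
        define v where "v = of_real h * Ln u / (2 * of_real pi * \<i>)"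
        have qv: "q v = u" using assms \<open>u \<noteq> 0\<close> by (simp add: q_def v_def)
        then have "exp (- (2 * pi / h) * Im v) = exp (- (2 * pi / h) * (c0 / 2))"
          using nq[of v] that unfolding R_def by metis
        then have Imv: "Im v = c0 / 2" using assms by simp
        then have "v \<in> upper_half_plane" using assms by (simp add: upper_half_plane_def)
        then show ?thesis
          using bd[of v] H(3)[of v] Imv qv assms by (simp add: pos_le_divide_eq)
      qed
      show "norm (q w) \<le> r" using w assms unfolding nq r_def by (simp add: divide_right_mono)
    qed (use s rR in auto)
    then have "norm (G w) \<le> S / sqrt (c0 / 2) ^ W * (norm (q w) / (R - s)) * \<rho> ^ M"
      using H(3)[of w] Im_w by (simp add: cardZ \<rho>_def upper_half_plane_def)
    then have "norm (G w) * sqrt (Im w) ^ W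
        \<le> S / sqrt (c0 / 2) ^ W * (norm (q w) / (R - s)) * \<rho> ^ M * sqrt (Im w) ^ W"
      by (rule mult_right_mono) (use Im_w in auto)
    also have "\<dots> = S / ((R - s) * sqrt (c0 / 2) ^ W) * \<rho> ^ M * (sqrt (Im w) ^ W * norm (q w))"
      by (simp add: field_simps)
    also have "\<dots> \<le> S / ((R - s) * sqrt (c0 / 2) ^ W) * \<rho> ^ M * C"
      using C(2)[OF Im_w] S0 s \<rho> assms unfolding nq by (intro mult_left_mono) auto
    also have "\<dots> = S * A * \<rho> ^ M" by (simp add: A_def)
    also have "\<dots> \<le> S * A * (1 / (16 * A))"
      using M S0 A by (intro mult_left_mono) auto
    also have "\<dots> = S / 16" using A by simp
    finally show "norm (G w) * sqrt (Im w) ^ W \<le> S / 16" .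
  qed
qed

section \<open>The modular group\<close>

type_synonym mat = "int \<times> int \<times> int \<times> int"

fun mmul :: "mat \<Rightarrow> mat \<Rightarrow> mat" where
  "mmul (a, b, c, d) (a', b', c', d') =
     (a * a' + b * c', a * b' + b * d', c * a' + d * c', c * b' + d * d')"

fun minv :: "mat \<Rightarrow> mat" where "minv (a, b, c, d) = (d, - b, - c, a)"

fun act :: "mat \<Rightarrow> complex \<Rightarrow> complex" where "act (a, b, c, d) z = moebius a b c d z"

fun den :: "mat \<Rightarrow> complex \<Rightarrow> complex" where "den (a, b, c, d) z = of_int c * z + of_int d"

definition SL2 :: "mat set" where
  "SL2 = {(a, b, c, d). a * d - b * c = 1}"

definition Gamma0 :: "nat \<Rightarrow> mat set" where
  "Gamma0 N = {(a, b, c, d). a * d - b * c = 1 \<and> int N dvd c}"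

text \<open>The principal congruence subgroup. Conjugates of the translation by \<open>N\<close> lie
  in it, and the multipliers below are signs on it.\<close>

definition GammaN :: "nat \<Rightarrow> mat set" where
  "GammaN N = {(a, b, c, d). a * d - b * c = 1 \<and>
     int N dvd a - 1 \<and> int N dvd b \<and> int N dvd c \<and> int N dvd d - 1}"

lemma GammaN_subset_Gamma0: "GammaN N \<subseteq> Gamma0 N" and Gamma0_subset_SL2: "Gamma0 N \<subseteq> SL2"
  by (auto simp: GammaN_def Gamma0_def SL2_def)

lemma mmul_SL2: "\<gamma> \<in> SL2 \<Longrightarrow> \<delta> \<in> SL2 \<Longrightarrow> mmul \<gamma> \<delta> \<in> SL2"
proof (cases \<gamma>; cases \<delta>)
  fix a b c d a' b' c' d' :: int
  assume "\<gamma> = (a, b, c, d)" "\<delta> = (a', b', c', d')" "\<gamma> \<in> SL2" "\<delta> \<in> SL2"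
  moreover have "(a * a' + b * c') * (c * b' + d * d') - (a * b' + b * d') * (c * a' + d * c')
      = (a * d - b * c) * (a' * d' - b' * c')" by (simp add: algebra_simps)
  ultimately show ?thesis by (simp add: SL2_def)
qed

lemma mmul_Gamma0:
  assumes "\<gamma> \<in> Gamma0 N" "\<delta> \<in> Gamma0 N"
  shows "mmul \<gamma> \<delta> \<in> Gamma0 N"
proof -
  have "mmul \<gamma> \<delta> \<in> SL2" using assms Gamma0_subset_SL2 by (blast intro: mmul_SL2)
  then show ?thesis
    using assms by (cases \<gamma>; cases \<delta>) (auto simp: Gamma0_def SL2_def)
qed

lemma minv_SL2: "\<gamma> \<in> SL2 \<Longrightarrow> minv \<gamma> \<in> SL2"
  by (cases \<gamma>) (auto simp: SL2_def algebra_simps)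

lemma minv_Gamma0: "\<gamma> \<in> Gamma0 N \<Longrightarrow> minv \<gamma> \<in> Gamma0 N"
  by (cases \<gamma>) (auto simp: Gamma0_def algebra_simps)

lemma mmul_assoc: "mmul (mmul \<gamma> \<delta>) \<epsilon> = mmul \<gamma> (mmul \<delta> \<epsilon>)"
  by (cases \<gamma>; cases \<delta>; cases \<epsilon>) (simp add: algebra_simps)

lemma mmul_minv_left: "\<gamma> \<in> SL2 \<Longrightarrow> mmul (minv \<gamma>) \<gamma> = (1, 0, 0, 1)"
  and mmul_minv_right: "\<gamma> \<in> SL2 \<Longrightarrow> mmul \<gamma> (minv \<gamma>) = (1, 0, 0, 1)"
  by (cases \<gamma>; auto simp: SL2_def algebra_simps)+

lemma mmul_one: "mmul \<gamma> (1, 0, 0, 1) = \<gamma>" "mmul (1, 0, 0, 1) \<gamma> = \<gamma>"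
  by (cases \<gamma>; simp)+

lemma minv_mmul: "minv (mmul \<gamma> \<delta>) = mmul (minv \<delta>) (minv \<gamma>)"
  by (cases \<gamma>; cases \<delta>) (simp add: algebra_simps)

lemma den_nonzero:
  assumes "\<gamma> \<in> SL2" "z \<in> upper_half_plane"
  shows "den \<gamma> z \<noteq> 0"
proof (cases \<gamma>)
  case (fields a b c d)
  show ?thesis
  proof
    assume "den \<gamma> z = 0"
    then have eq: "of_int c * z + of_int d = 0" by (simp add: fields)
    then have "Im (of_int c * z + of_int d) = 0" by simp
    then have "c = 0" using assms by (auto simp: upper_half_plane_def)
    moreover from this eq have "d = 0" by simp
    ultimately show False using assms by (simp add: fields SL2_def)
  qed
qed

lemma Im_act:
  assumes "\<gamma> \<in> SL2"
  shows "Im (act \<gamma> z) = Im z / (norm (den \<gamma> z))\<^sup>2"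
proof (cases \<gamma>)
  case (fields a b c d)
  then have det: "real_of_int a * d - b * c = 1"
    using assms by (simp add: SL2_def flip: of_int_mult of_int_diff)
  have "a * Im z * (c * Re z + d) - (a * Re z + b) * (c * Im z) = (real_of_int a * d - b * c) * Im z"
    by (simp add: algebra_simps)
  then show ?thesis
    using det by (simp add: fields moebius_def Im_divide cmod_power2)
qed

lemma act_upper:
  assumes "\<gamma> \<in> SL2" "z \<in> upper_half_plane"
  shows "act \<gamma> z \<in> upper_half_plane"
  using assms den_nonzero[OF assms] by (simp add: upper_half_plane_def Im_act)

lemma den_mmul:
  assumes "\<delta> \<in> SL2" "z \<in> upper_half_plane"
  shows "den (mmul \<gamma> \<delta>) z = den \<gamma> (act \<delta> z) * den \<delta> z"
  using den_nonzero[OF assms] by (cases \<gamma>; cases \<delta>) (simp add: moebius_def field_simps)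

lemma act_mmul:
  assumes "\<gamma> \<in> SL2" "\<delta> \<in> SL2" "z \<in> upper_half_plane"
  shows "act (mmul \<gamma> \<delta>) z = act \<gamma> (act \<delta> z)"
proof (cases \<gamma>; cases \<delta>)
  fix a b c d a' b' c' d' :: int
  assume eq: "\<gamma> = (a, b, c, d)" "\<delta> = (a', b', c', d')"
  define D where "D = den \<delta> z"
  have D: "D \<noteq> 0" using den_nonzero assms by (simp add: D_def)
  define w where "w = act \<delta> z"
  have w: "w * D = of_int a' * z + of_int b'"
    using D by (simp add: w_def D_def eq moebius_def)
  have D': "D = of_int c' * z + of_int d'" by (simp add: D_def eq)
  have num: "of_int (a * a' + b * c') * z + of_int (a * b' + b * d') = (of_int a * w + of_int b) * D"
    by (simp only: distrib_right mult.assoc w) (simp add: D' algebra_simps)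
  have den: "of_int (c * a' + d * c') * z + of_int (c * b' + d * d') = (of_int c * w + of_int d) * D"
    by (simp only: distrib_right mult.assoc w) (simp add: D' algebra_simps)
  have "act (mmul \<gamma> \<delta>) z = (of_int a * w + of_int b) * D / ((of_int c * w + of_int d) * D)"
    unfolding eq mmul.simps act.simps moebius_def num den ..
  also have "\<dots> = act \<gamma> w" using D by (simp add: eq moebius_def)
  finally show ?thesis by (simp add: w_def)
qed

lemma act_one: "act (1, 0, 0, 1) z = z"
  by (simp add: moebius_def)

lemma holomorphic_act:
  assumes "\<gamma> \<in> SL2"
  shows "act \<gamma> holomorphic_on upper_half_plane" "den \<gamma> holomorphic_on upper_half_plane"
proof -
  obtain a b c d where g: "\<gamma> = (a, b, c, d)" by (cases \<gamma>)
  have e: "act \<gamma> = (\<lambda>z. (of_int a * z + of_int b) / (of_int c * z + of_int d))"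
    "den \<gamma> = (\<lambda>z. of_int c * z + of_int d)"
    by (auto simp: g moebius_def)
  have "of_int c * z + of_int d \<noteq> (0::complex)" if "z \<in> upper_half_plane" for z
    using den_nonzero[OF assms that] by (simp add: g)
  then show "act \<gamma> holomorphic_on upper_half_plane" "den \<gamma> holomorphic_on upper_half_plane"
    unfolding e by (auto intro!: holomorphic_intros)
qed

lemma open_upper_half_plane: "open upper_half_plane"
  and connected_upper_half_plane: "connected upper_half_plane"
  unfolding upper_half_plane_def
  by (auto simp: open_halfspace_Im_gt convex_halfspace_Im_gt intro: convex_connected)

text \<open>A weak fundamental domain from Dirichlet approximation. For z = x + i y with y < 1 there
  are coprime h, c with c <= M and |c x - h| < 1/M, where M is about 1 / sqrt y. Then |c x - h| <=
  sqrt y and c y <= 2 sqrt y, so |c z - h|^2 <= 5 y.\<close>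

lemma exists_act_Im_ge:
  assumes "z \<in> upper_half_plane"
  obtains \<gamma> where "\<gamma> \<in> SL2" "Im (act \<gamma> z) \<ge> 1 / 5"
proof (cases "Im z \<ge> 1")
  case True
  then show ?thesis
    by (intro that[of "(1, 0, 0, 1)"]) (auto simp: SL2_def moebius_def)
next
  case False
  define y where "y = Im z"
  have y: "0 < y" "y < 1" using assms False by (auto simp: y_def upper_half_plane_def)
  define M where "M = nat \<lceil>1 / sqrt y\<rceil>"
  have "1 / sqrt y > 0" using y by simp
  then have M: "M > 0" "1 / sqrt y \<le> M" "M < 1 / sqrt y + 1"
    unfolding M_def by linarith+
  obtain h c where hc: "coprime h c" "0 < c" "c \<le> int M" "\<bar>of_int c * Re z - of_int h\<bar> < 1 / M"
    using Dirichlet_approx_coprime[OF M(1)] by metis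
  obtain u v where uv: "u * h + v * c = 1"
    using hc(1) by (metis bezout_int coprime_iff_gcd_eq_1)
  define \<gamma> :: mat where "\<gamma> = (- u, - v, c, - h)"
  have \<gamma>: "\<gamma> \<in> SL2" using uv by (simp add: \<gamma>_def SL2_def)
  have "(c * Re z - h)\<^sup>2 \<le> y"
  proof -
    have "1 / M \<le> sqrt y" using M y by (simp add: field_simps)
    then have "\<bar>of_int c * Re z - of_int h\<bar> \<le> sqrt y" using hc by linarith
    then show ?thesis using y by (metis abs_le_square_iff abs_of_nonneg less_eq_real_def real_sqrt_ge_0_iff real_sqrt_pow2)
  qed
  moreover have "(c * y)\<^sup>2 \<le> 4 * y"
  proof -
    have "1 \<le> 1 / sqrt y" using y by simp
    then have "real_of_int c \<le> 2 / sqrt y" using hc(3) M by linarith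
    then have "c * y \<le> 2 / sqrt y * y" using y by (intro mult_right_mono) auto
    also have "\<dots> = 2 * sqrt y" using y real_div_sqrt[of y] by (simp flip: times_divide_eq_right)
    finally have "(c * y)\<^sup>2 \<le> (2 * sqrt y)\<^sup>2"
      using hc y by (intro power_mono) auto
    then show ?thesis using y by (simp add: power_mult_distrib)
  qed
  moreover have "(norm (den \<gamma> z))\<^sup>2 = (c * Re z - h)\<^sup>2 + (c * y)\<^sup>2"
    by (simp add: \<gamma>_def cmod_power2 y_def)
  ultimately have "(norm (den \<gamma> z))\<^sup>2 \<le> 5 * y" by linarith
  moreover have "(norm (den \<gamma> z))\<^sup>2 > 0" using den_nonzero[OF \<gamma> assms] by simp
  ultimately have "Im (act \<gamma> z) \<ge> 1 / 5"
    by (simp add: Im_act[OF \<gamma>] field_simps y_def)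
  then show ?thesis using that \<gamma> by blast
qed

text \<open>One matrix is chosen for each residue matrix modulo \<open>N\<close> that occurs;
  congruent matrices differ by an element of \<open>GammaN N\<close>.\<close>

lemma finite_SL2_mod:
  assumes "N > 0"
  obtains R where "finite R" "R \<subseteq> SL2"
    "\<And>\<gamma>. \<gamma> \<in> SL2 \<Longrightarrow> \<exists>\<sigma>\<in>R. mmul \<gamma> (minv \<sigma>) \<in> GammaN N"
proof -
  define red :: "mat \<Rightarrow> mat" where
    "red = (\<lambda>(a, b, c, d). (a mod int N, b mod int N, c mod int N, d mod int N))"
  define R where "R = inv_into SL2 red ` red ` SL2"
  have "red ` SL2 \<subseteq> {0..<int N} \<times> {0..<int N} \<times> {0..<int N} \<times> {0..<int N}"
    using assms by (auto simp: red_def)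
  then have "finite (red ` SL2)" by (rule finite_subset) auto
  then have "finite R" by (simp add: R_def)
  moreover have "R \<subseteq> SL2" by (auto simp: R_def inv_into_into)
  moreover have "\<exists>\<sigma>\<in>R. mmul \<gamma> (minv \<sigma>) \<in> GammaN N" if "\<gamma> \<in> SL2" for \<gamma>
  proof
    define \<sigma> where "\<sigma> = inv_into SL2 red (red \<gamma>)"
    show "\<sigma> \<in> R" using that by (auto simp: \<sigma>_def R_def)
    then have \<sigma>: "\<sigma> \<in> SL2" "red \<sigma> = red \<gamma>"
      using \<open>R \<subseteq> SL2\<close> that by (auto simp: \<sigma>_def f_inv_into_f)
    obtain a b c d a' b' c' d' where eq: "\<gamma> = (a, b, c, d)" "\<sigma> = (a', b', c', d')"
      by (cases \<gamma>; cases \<sigma>)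
    have cong: "[a = a'] (mod int N)" "[b = b'] (mod int N)" "[c = c'] (mod int N)" "[d = d'] (mod int N)"
      using \<sigma>(2) by (auto simp: red_def eq cong_def)
    have det: "a' * d' - b' * c' = 1" using \<sigma>(1) by (simp add: eq SL2_def)
    have "[a * d' - b * c' = a' * d' - b' * c'] (mod int N)"
         "[- a * b' + b * a' = - a' * b' + b' * a'] (mod int N)"
         "[c * d' - d * c' = c' * d' - d' * c'] (mod int N)"
         "[- c * b' + d * a' = - c' * b' + d' * a'] (mod int N)"
      by (intro cong_diff cong_add cong_mult; use cong in \<open>simp add: cong_minus_minus_iff\<close>)+
    moreover have "mmul \<gamma> (minv \<sigma>) \<in> SL2"
      using that \<sigma>(1) by (intro mmul_SL2 minv_SL2)
    ultimately show "mmul \<gamma> (minv \<sigma>) \<in> GammaN N"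
      using det by (simp add: eq GammaN_def SL2_def cong_iff_dvd_diff algebra_simps)
  qed
  ultimately show ?thesis by (rule that)
qed

section \<open>Forms with a multiplier system\<close>

lemma Gamma0_lower_row:
  assumes "(a, b, c, d) \<in> Gamma0 N"
  shows "coprime c d" "int N dvd c"
proof -
  have "a * d - b * c = 1" using assms by (simp add: Gamma0_def)
  then show "coprime c d"
    by (intro coprimeI) (metis dvd_diff dvd_mult)
  show "int N dvd c" using assms by (simp add: Gamma0_def)
qed

text \<open>Here \<open>W\<close> is twice the weight.\<close>

locale multiplier =
  fixes N W :: nat and \<nu> :: "int \<Rightarrow> int \<Rightarrow> complex"
  assumes N_pos: "N > 0" and W_pos: "W > 0"
    and norm_nu: "coprime c d \<Longrightarrow> int N dvd c \<Longrightarrow> norm (\<nu> c d) = 1"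
    and nu_sq: "coprime c d \<Longrightarrow> int N dvd c \<Longrightarrow> int N dvd d - 1 \<Longrightarrow> (\<nu> c d)\<^sup>2 = 1"
    and nu_one: "\<nu> 0 1 = 1"
begin

fun J :: "mat \<Rightarrow> complex \<Rightarrow> complex" where
  "J (a, b, c, d) z = \<nu> c d * csqrt (of_int c * z + of_int d) ^ W"

text \<open>Im z to half the weight, that is to the power W/4, so that
  \<open>norm (g z) * wt z\<close> is invariant under \<open>Gamma0 N\<close>.\<close>

definition wt :: "complex \<Rightarrow> real" where
  "wt z = sqrt (sqrt (Im z)) ^ W"

text \<open>Boundedness replaces vanishing at the cusps: cusp forms satisfy it by
  \<open>cusp_form_bounded\<close>, and it passes to the trace without any computation at the
  cusps.\<close>

definition forms :: "(complex \<Rightarrow> complex) set" where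
  "forms = {g. g holomorphic_on upper_half_plane \<and>
     (\<forall>\<gamma>\<in>Gamma0 N. \<forall>z\<in>upper_half_plane. g (act \<gamma> z) = J \<gamma> z * g z) \<and>
     (\<exists>S. \<forall>z\<in>upper_half_plane. norm (g z) * wt z \<le> S)}"

lemma norm_J:
  assumes "\<gamma> \<in> Gamma0 N"
  shows "norm (J \<gamma> z) = sqrt (norm (den \<gamma> z)) ^ W"
  using assms Gamma0_lower_row by (cases \<gamma>) (simp add: norm_mult norm_power norm_nu)

text \<open>Squaring removes both the sign of the multiplier and the branch of the square root, so
  squares of forms have integral weight \<open>W\<close> and trivial multiplier on
  \<open>GammaN N\<close>.\<close>

lemma J_sq:
  assumes "\<gamma> \<in> GammaN N"
  shows "(J \<gamma> z)\<^sup>2 = den \<gamma> z ^ W"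
proof (cases \<gamma>)
  case (fields a b c d)
  then have "(a, b, c, d) \<in> Gamma0 N" using assms GammaN_subset_Gamma0 by blast
  note Gamma0_lower_row[OF this]
  moreover have "int N dvd d - 1" using assms by (simp add: fields GammaN_def)
  ultimately have "(\<nu> c d)\<^sup>2 = 1" by (rule nu_sq)
  then have "(J \<gamma> z)\<^sup>2 = ((csqrt (of_int c * z + of_int d))\<^sup>2) ^ W"
    by (simp only: fields J.simps power_mult_distrib mult_1 mult.commute[of W] flip: power_mult)
  then show ?thesis by (simp add: fields)
qed

lemma wt_pos: "z \<in> upper_half_plane \<Longrightarrow> wt z > 0"
  by (simp add: wt_def upper_half_plane_def)

lemma wt_sq: "z \<in> upper_half_plane \<Longrightarrow> (wt z)\<^sup>2 = sqrt (Im z) ^ W"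
  by (simp add: wt_def upper_half_plane_def flip: power_mult)
     (simp add: power_mult mult.commute[of W])

lemma wt_act:
  assumes "\<gamma> \<in> SL2" "z \<in> upper_half_plane"
  shows "wt (act \<gamma> z) = wt z / sqrt (norm (den \<gamma> z)) ^ W"
  using den_nonzero[OF assms] assms
  by (simp add: wt_def Im_act real_sqrt_divide power_divide)

lemma norm_wt_invariant:
  assumes "g (act \<gamma> z) = J \<gamma> z * g z" "\<gamma> \<in> Gamma0 N" "z \<in> upper_half_plane"
  shows "norm (g (act \<gamma> z)) * wt (act \<gamma> z) = norm (g z) * wt z"
proof -
  have "\<gamma> \<in> SL2" using assms Gamma0_subset_SL2 by blast
  then show ?thesis
    using den_nonzero[of \<gamma> z] assms by (simp add: wt_act norm_mult norm_J)
qed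

text \<open>If \<gamma> lifts z to height 1/5, write the inverse of \<gamma> as \<delta> \<sigma>
  with \<delta> in \<open>GammaN N\<close> and \<sigma> in \<open>R\<close>. Then z = \<delta>
  \<sigma> w for w = \<gamma> z, and \<delta> does not change the invariant norm.\<close>

lemma reduce_to_representatives:
  assumes R: "R \<subseteq> SL2" "\<And>\<gamma>. \<gamma> \<in> SL2 \<Longrightarrow> \<exists>\<sigma>\<in>R. mmul \<gamma> (minv \<sigma>) \<in> GammaN N"
    and g: "\<And>\<gamma> z. \<gamma> \<in> Gamma0 N \<Longrightarrow> z \<in> upper_half_plane \<Longrightarrow> g (act \<gamma> z) = J \<gamma> z * g z"
    and z: "z \<in> upper_half_plane"
  obtains \<sigma> w where "\<sigma> \<in> R" "Im w \<ge> 1 / 5"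
    "norm (g z) * wt z = norm (g (act \<sigma> w)) * wt (act \<sigma> w)"
proof -
  obtain \<gamma> where \<gamma>: "\<gamma> \<in> SL2" "Im (act \<gamma> z) \<ge> 1 / 5" using exists_act_Im_ge[OF z] .
  obtain \<sigma> where \<sigma>: "\<sigma> \<in> R" "mmul (minv \<gamma>) (minv \<sigma>) \<in> GammaN N"
    using R(2)[OF minv_SL2[OF \<gamma>(1)]] by blast
  define \<delta> where "\<delta> = mmul (minv \<gamma>) (minv \<sigma>)"
  define w where "w = act \<gamma> z"
  have w: "w \<in> upper_half_plane" using act_upper[OF \<gamma>(1) z] by (simp add: w_def)
  have s: "\<sigma> \<in> SL2" using R \<sigma> by blast
  have \<delta>: "\<delta> \<in> Gamma0 N" "\<delta> \<in> SL2"
    using \<sigma>(2) GammaN_subset_Gamma0 Gamma0_subset_SL2 unfolding \<delta>_def by blast+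
  have "act \<delta> (act \<sigma> w) = act (mmul \<delta> \<sigma>) w"
    using \<delta> s w by (simp add: act_mmul)
  also have "mmul \<delta> \<sigma> = minv \<gamma>"
    by (simp add: \<delta>_def mmul_assoc mmul_minv_left[OF s] mmul_one)
  also have "act (minv \<gamma>) w = act (mmul (minv \<gamma>) \<gamma>) z"
    using \<gamma> z by (simp add: w_def act_mmul minv_SL2)
  also have "\<dots> = z" using \<gamma> by (simp add: mmul_minv_left act_one del: act.simps)
  finally have "z = act \<delta> (act \<sigma> w)" ..
  then have "norm (g z) * wt z = norm (g (act \<sigma> w)) * wt (act \<sigma> w)"
    using norm_wt_invariant[of g \<delta> "act \<sigma> w"] g \<delta> act_upper[OF s w] by simp
  then show ?thesis using that \<sigma>(1) \<gamma>(2) by (simp add: w_def)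
qed

theorem forms_determined_by_finitely_many_values:
  obtains E where "finite E" "E \<subseteq> upper_half_plane"
    "\<And>g z. g \<in> forms \<Longrightarrow> (\<And>e. e \<in> E \<Longrightarrow> g e = 0) \<Longrightarrow> z \<in> upper_half_plane \<Longrightarrow> g z = 0"
proof -
  obtain R where R: "finite R" "R \<subseteq> SL2"
      "\<And>\<gamma>. \<gamma> \<in> SL2 \<Longrightarrow> \<exists>\<sigma>\<in>R. mmul \<gamma> (minv \<sigma>) \<in> GammaN N"
    using finite_SL2_mod[OF N_pos] by blast
  obtain P where P: "finite P" "P \<subseteq> upper_half_plane"
    "\<And>G S w. \<lbrakk>G holomorphic_on upper_half_plane;
        \<And>w. w \<in> upper_half_plane \<Longrightarrow> G (w + of_real N) = G w;
        \<And>w. w \<in> upper_half_plane \<Longrightarrow> norm (G w) * sqrt (Im w) ^ W \<le> S;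
        \<And>w. w \<in> P \<Longrightarrow> G w = 0; Im w \<ge> 1 / 5\<rbrakk> \<Longrightarrow> norm (G w) * sqrt (Im w) ^ W \<le> S / 16"
    by (rule periodic_small_of_vanishing[of "real N" W "1 / 5"]) (use N_pos W_pos in auto)
  \<comment> \<open>Zeros are prescribed near every cusp: the points of \<open>P\<close> are
    transported by all representatives.\<close>
  define E where "E = (\<lambda>(\<sigma>, w). act \<sigma> w) ` (R \<times> P)"
  show ?thesis
  proof (rule that[of E])
    show "finite E" using R P by (simp add: E_def)
    show "E \<subseteq> upper_half_plane" using R P by (auto simp: E_def intro!: act_upper)
    fix g z0
    assume g: "g \<in> forms" and g0: "\<And>e. e \<in> E \<Longrightarrow> g e = 0" and z0: "z0 \<in> upper_half_plane"
    define \<phi> where "\<phi> = (\<lambda>z. norm (g z) * wt z)"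
    define S where "S = (SUP z\<in>upper_half_plane. \<phi> z)"
    have hol: "g holomorphic_on upper_half_plane"
      and mod: "\<And>\<gamma> z. \<gamma> \<in> Gamma0 N \<Longrightarrow> z \<in> upper_half_plane \<Longrightarrow> g (act \<gamma> z) = J \<gamma> z * g z"
      and bdd: "bdd_above (\<phi> ` upper_half_plane)"
      using g by (auto simp: forms_def \<phi>_def bdd_above_def)
    have le: "\<phi> z \<le> S" if "z \<in> upper_half_plane" for z
      unfolding S_def using that bdd by (rule cSUP_upper)
    show "g z0 = 0"
    proof (rule ccontr)
      assume "g z0 \<noteq> 0"
      then have "\<phi> z0 > 0" using wt_pos[OF z0] by (simp add: \<phi>_def)
      with le[OF z0] have S: "S > 0" by linarith
      \<comment> \<open>The supremum need not be attained; a point above S/2 is enough, because the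
        zeros will force the value there down to S/4.\<close>
      then have "S / 2 < (SUP z\<in>upper_half_plane. \<phi> z)" by (simp add: S_def)
      then obtain z where z: "z \<in> upper_half_plane" "\<phi> z > S / 2"
        using less_cSUP_iff[OF _ bdd] z0 by blast
      obtain \<sigma> w where \<sigma>w: "\<sigma> \<in> R" "Im w \<ge> 1 / 5" "\<phi> z = \<phi> (act \<sigma> w)"
        unfolding \<phi>_def using reduce_to_representatives[OF R(2,3) mod z(1)] by metis
      have s: "\<sigma> \<in> SL2" using R \<sigma>w by blast
      define G where "G = (\<lambda>w. (g (act \<sigma> w))\<^sup>2 / den \<sigma> w ^ W)"
      have G\<phi>: "norm (G w) * sqrt (Im w) ^ W = (\<phi> (act \<sigma> w))\<^sup>2" if "w \<in> upper_half_plane" for w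
      proof -
        have "(\<phi> (act \<sigma> w))\<^sup>2 = (norm (g (act \<sigma> w)))\<^sup>2 * sqrt (Im (act \<sigma> w)) ^ W"
          using act_upper[OF s that] by (simp add: \<phi>_def power_mult_distrib wt_sq)
        also have "sqrt (Im (act \<sigma> w)) = sqrt (Im w) / norm (den \<sigma> w)"
          by (simp add: Im_act[OF s] real_sqrt_divide)
        finally show ?thesis
          by (simp add: G_def norm_divide norm_power power_divide)
      qed
      have "norm (G w) * sqrt (Im w) ^ W \<le> S\<^sup>2 / 16"
      proof (rule P(3))
        show "G holomorphic_on upper_half_plane"
        proof -
          have "(\<lambda>w. g (act \<sigma> w)) holomorphic_on upper_half_plane"
            by (rule holomorphic_on_compose_gen[OF holomorphic_act(1)[OF s] hol, unfolded o_def])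
               (use act_upper[OF s] in auto)
          moreover have "(\<lambda>w. den \<sigma> w) holomorphic_on upper_half_plane"
            using holomorphic_act(2)[OF s] by simp
          ultimately show ?thesis
            unfolding G_def using den_nonzero[OF s] by (intro holomorphic_intros) auto
        qed
        show "norm (G w) * sqrt (Im w) ^ W \<le> S\<^sup>2" if "w \<in> upper_half_plane" for w
        proof -
          have "0 \<le> \<phi> (act \<sigma> w)" using act_upper[OF s that] wt_pos
            by (simp add: \<phi>_def less_imp_le)
          then show ?thesis
            unfolding G\<phi>[OF that] using le[OF act_upper[OF s that]] by (intro power_mono)
        qed
        show "G w = 0" if "w \<in> P" for w
        proof -
          have "act \<sigma> w \<in> E" using \<sigma>w(1) that by (auto simp: E_def)
          then show ?thesis using g0 by (simp add: G_def)
        qed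
        show "G (w + of_real N) = G w" if w: "w \<in> upper_half_plane" for w
        proof -
          define t :: mat where "t = (1, int N, 0, 1)"
          have t: "t \<in> SL2" "act t w = w + of_real N" "den t w = 1"
            by (auto simp: t_def SL2_def moebius_def)
          \<comment> \<open>The conjugate of a translation that is trivial modulo \<open>N\<close>.
            It turns the shift of w by \<open>N\<close> into the action of an element of
            \<open>GammaN N\<close> on \<sigma> w, where \<open>J_sq\<close> applies.\<close>
          define \<delta> where "\<delta> = mmul (mmul \<sigma> t) (minv \<sigma>)"
          have \<delta>: "\<delta> \<in> GammaN N"
          proof -
            have "\<delta> \<in> SL2" unfolding \<delta>_def using s t by (intro mmul_SL2 minv_SL2)
            then show ?thesis using s
              by (cases \<sigma>) (auto simp: \<delta>_def t_def GammaN_def SL2_def algebra_simps)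
          qed
          then have \<delta>': "\<delta> \<in> Gamma0 N" "\<delta> \<in> SL2"
            using GammaN_subset_Gamma0 Gamma0_subset_SL2 by blast+
          have eq: "mmul \<sigma> t = mmul \<delta> \<sigma>"
            by (simp add: \<delta>_def mmul_assoc mmul_minv_left[OF s] mmul_one)
          define u where "u = act \<sigma> w"
          have u: "u \<in> upper_half_plane" using act_upper[OF s w] by (simp add: u_def)
          have "act \<sigma> (w + of_real N) = act \<delta> u"
            using act_mmul[OF s t(1) w] act_mmul[OF \<delta>'(2) s w] by (simp add: eq t(2) u_def)
          moreover have "den \<sigma> (w + of_real N) = den \<delta> u * den \<sigma> w"
            using den_mmul[OF t(1) w, of \<sigma>] den_mmul[OF s w, of \<delta>] by (simp add: eq t u_def)
          ultimately have "G (w + of_real N) = (J \<delta> u * g u)\<^sup>2 / (den \<delta> u * den \<sigma> w) ^ W"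
            using mod[OF \<delta>'(1) u] by (simp add: G_def)
          also have "\<dots> = (g u)\<^sup>2 / den \<sigma> w ^ W"
            using den_nonzero[OF \<delta>'(2) u] by (simp add: power_mult_distrib J_sq[OF \<delta>])
          finally show ?thesis by (simp add: G_def u_def)
        qed
      qed (fact \<sigma>w)
      moreover have "w \<in> upper_half_plane" using \<sigma>w by (simp add: upper_half_plane_def)
      ultimately have "(\<phi> (act \<sigma> w))\<^sup>2 \<le> S\<^sup>2 / 16"
        using G\<phi>[of w] by simp
      then have "(\<phi> z)\<^sup>2 \<le> (S / 4)\<^sup>2"
        unfolding \<sigma>w(3) by (simp add: power_divide)
      then have "\<phi> z \<le> S / 4" by (rule power2_le_imp_le) (use S in simp)
      with z(2) S show False by simp
    qed
  qed
qed

text \<open>Terms are compared with those at height 1/5: since n >= 1, each gains at least the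
  factor exp(-c (Im z - 1/5)). The resulting exponential decay beats \<open>wt\<close>.\<close>

lemma fourier_expansion_bounded:
  assumes h: "h > (0::nat)"
    and F: "\<And>z. z \<in> upper_half_plane \<Longrightarrow>
      ((\<lambda>n::nat. C n * exp (2 * of_real pi * \<i> * of_nat n * z / of_nat h)) has_sum F z) {1..}"
  obtains B where "\<And>z. Im z \<ge> 1 / 5 \<Longrightarrow> norm (F z) * wt z \<le> B"
proof -
  define c where "c = 2 * pi / h"
  have c: "c > 0" using h by (simp add: c_def)
  have nrm: "norm (C n * exp (2 * of_real pi * \<i> * of_nat n * z / of_nat h))
      = norm (C n) * exp (- c * n * Im z)" for n z
    by (simp add: norm_mult c_def)
  have summ: "(\<lambda>n. norm (C n) * exp (- c * n * Im z)) summable_on {1..}" if "z \<in> upper_half_plane" for z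
  proof -
    have "(\<lambda>n::nat. C n * exp (2 * of_real pi * \<i> * of_nat n * z / of_nat h)) summable_on {1..}"
      using F[OF that] by (auto simp: summable_on_def)
    then show ?thesis
      unfolding nrm[symmetric] by (simp only: summable_on_iff_abs_summable_on_complex)
  qed
  define y0 :: complex where "y0 = \<i> / 5"
  have y0: "y0 \<in> upper_half_plane" "Im y0 = 1 / 5" by (auto simp: y0_def upper_half_plane_def)
  define A where "A = (\<Sum>\<^sub>\<infinity>n\<in>{1..}. norm (C n) * exp (- c * real n * Im y0))"
  have A: "A \<ge> 0" unfolding A_def by (rule infsum_nonneg) simp
  obtain D where D: "D > 0" "\<And>y. y > 0 \<Longrightarrow> sqrt y ^ W * exp (- (2 * c) * y) \<le> D"
    using sqrt_power_exp_bounded[of "2 * c" W] c by auto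
  have "norm (F z) * wt z \<le> exp (c / 5) * A * sqrt D" if z: "Im z \<ge> 1 / 5" for z
  proof -
    have zu: "z \<in> upper_half_plane" using z by (simp add: upper_half_plane_def)
    have "norm (F z) \<le> (\<Sum>\<^sub>\<infinity>n\<in>{1..}. norm (C n) * exp (- c * real n * Im z))"
    proof (rule norm_has_sum_bound[OF _ F[OF zu]])
      show "((\<lambda>n. norm (C n * exp (2 * of_real pi * \<i> * of_nat n * z / of_nat h))) has_sum
          (\<Sum>\<^sub>\<infinity>n\<in>{1..}. norm (C n) * exp (- c * real n * Im z))) {1..}"
        unfolding nrm using summ[OF zu] by (rule has_sum_infsum)
    qed
    also have "\<dots> \<le> (\<Sum>\<^sub>\<infinity>n\<in>{1..}. exp (- c * (Im z - 1 / 5)) * (norm (C n) * exp (- c * real n * Im y0)))"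
    proof (rule infsum_mono[OF summ[OF zu] summable_on_cmult_right[OF summ[OF y0(1)]]])
      fix n :: nat assume n: "n \<in> {1..}"
      have "c * (Im z - 1 / 5) \<le> real n * (c * (Im z - 1 / 5))"
        using n z c mult_right_mono[of 1 "real n" "c * (Im z - 1 / 5)"] by simp
      then have "- c * real n * Im z \<le> - c * (Im z - 1 / 5) + - c * real n * Im y0"
        by (simp add: y0(2) algebra_simps)
      then have "exp (- c * real n * Im z) \<le> exp (- c * (Im z - 1 / 5)) * exp (- c * real n * Im y0)"
        by (simp flip: exp_add)
      from mult_left_mono[OF this, of "norm (C n)"]
      show "norm (C n) * exp (- c * real n * Im z)
          \<le> exp (- c * (Im z - 1 / 5)) * (norm (C n) * exp (- c * real n * Im y0))"
        by (simp add: mult_ac)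
    qed
    also have "\<dots> = exp (- c * (Im z - 1 / 5)) * A"
      unfolding A_def by (rule infsum_cmult_right')
    also have "\<dots> = exp (c / 5) * A * exp (- c * Im z)"
    proof -
      have "- c * (Im z - 1 / 5) = c / 5 + - c * Im z" by (simp add: algebra_simps)
      then show ?thesis by (simp only: exp_add mult_ac)
    qed
    finally have "norm (F z) * wt z \<le> exp (c / 5) * A * exp (- c * Im z) * wt z"
      using wt_pos[OF zu] by (intro mult_right_mono) auto
    also have "\<dots> = exp (c / 5) * A * (wt z * exp (- c * Im z))" by simp
    also have "wt z * exp (- c * Im z) \<le> sqrt D"
    \<comment> \<open>Squared, because \<open>wt\<close> squared is the power of
      \<open>sqrt (Im z)\<close> that was estimated with rate 2 c.\<close>
    proof (rule real_le_rsqrt)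
      have "(wt z * exp (- c * Im z))\<^sup>2 = sqrt (Im z) ^ W * exp (- (2 * c) * Im z)"
        by (simp add: power_mult_distrib wt_sq[OF zu] flip: exp_of_nat_mult)
      then show "(wt z * exp (- c * Im z))\<^sup>2 \<le> D" using D(2)[of "Im z"] z by simp
    qed
    finally show ?thesis using A by (simp add: mult_left_mono)
  qed
  then show ?thesis by (rule that)
qed

text \<open>The expansion at the cusp \<sigma> \<infinity> bounds the invariant norm on the image
  under \<sigma> of Im w >= 1/5, and finitely many such regions meet every orbit.\<close>

lemma cusp_form_bounded:
  assumes mod: "\<And>\<gamma> z. \<gamma> \<in> Gamma0 N \<Longrightarrow> z \<in> upper_half_plane \<Longrightarrow> g (act \<gamma> z) = J \<gamma> z * g z"
    and van: "vanishes_at_cusps (\<lambda>c d z. csqrt (of_int c * z + of_int d) ^ W) g"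
  obtains S where "\<And>z. z \<in> upper_half_plane \<Longrightarrow> norm (g z) * wt z \<le> S"
proof -
  obtain R where R: "finite R" "R \<subseteq> SL2"
      "\<And>\<gamma>. \<gamma> \<in> SL2 \<Longrightarrow> \<exists>\<sigma>\<in>R. mmul \<gamma> (minv \<sigma>) \<in> GammaN N"
    using finite_SL2_mod[OF N_pos] by blast
  have "\<exists>B. \<forall>w. Im w \<ge> 1 / 5 \<longrightarrow> norm (g (act \<sigma> w)) * wt (act \<sigma> w) \<le> B" if \<sigma>: "\<sigma> \<in> R" for \<sigma>
  proof -
    have s: "\<sigma> \<in> SL2" using R \<sigma> by blast
    obtain a b c d where eq: "\<sigma> = (a, b, c, d)" by (cases \<sigma>)
    have "a * d - b * c = 1" using s by (simp add: eq SL2_def)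
    then obtain h C where h: "h > (0::nat)" and C: "\<And>z. z \<in> upper_half_plane \<Longrightarrow>
        ((\<lambda>n::nat. C n * exp (2 * of_real pi * \<i> * of_nat n * z / of_nat h)) has_sum
          (g (moebius a b c d z) / csqrt (of_int c * z + of_int d) ^ W)) {1..}"
      using van unfolding vanishes_at_cusps_def by meson
    obtain B where B: "\<And>z. Im z \<ge> 1 / 5 \<Longrightarrow>
        norm (g (moebius a b c d z) / csqrt (of_int c * z + of_int d) ^ W) * wt z \<le> B"
      using fourier_expansion_bounded[OF h C] by blast
    have "norm (g (act \<sigma> w)) * wt (act \<sigma> w) \<le> B" if "Im w \<ge> 1 / 5" for w
    proof -
      have "w \<in> upper_half_plane" using that by (simp add: upper_half_plane_def)
      then show ?thesis
        using B[OF that] by (simp add: wt_act[OF s] norm_divide norm_power) (simp add: eq)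
    qed
    then show ?thesis by blast
  qed
  then obtain B where B: "\<And>\<sigma> w. \<sigma> \<in> R \<Longrightarrow> Im w \<ge> 1 / 5 \<Longrightarrow> norm (g (act \<sigma> w)) * wt (act \<sigma> w) \<le> B \<sigma>"
    by metis
  show ?thesis
  proof (rule that[of "Max (B ` R)"])
    fix z assume z: "z \<in> upper_half_plane"
    obtain \<sigma> w where \<sigma>w: "\<sigma> \<in> R" "Im w \<ge> 1 / 5"
        "norm (g z) * wt z = norm (g (act \<sigma> w)) * wt (act \<sigma> w)"
      using reduce_to_representatives[OF R(2,3) mod z] by metis
    have "norm (g z) * wt z \<le> B \<sigma>" using B[OF \<sigma>w(1,2)] \<sigma>w(3) by simp
    also have "\<dots> \<le> Max (B ` R)" using R \<sigma>w by simp
    finally show "norm (g z) * wt z \<le> Max (B ` R)" .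
  qed
qed

end

section \<open>The Hecke operator as a trace\<close>

lemma csqrt_of_real_mult:
  assumes "x > 0"
  shows "csqrt (of_real x * z) = of_real (sqrt x) * csqrt z"
proof (rule csqrt_unique)
  show "(of_real (sqrt x) * csqrt z)\<^sup>2 = of_real x * z"
    using assms by (simp add: power_mult_distrib flip: of_real_power)
  show "0 < Re (of_real (sqrt x) * csqrt z) \<or>
      Re (of_real (sqrt x) * csqrt z) = 0 \<and> 0 \<le> Im (of_real (sqrt x) * csqrt z)"
    using csqrt_principal[of z] assms by auto
qed

text \<open>For c nonzero, c z + d has nonzero imaginary part and avoids the cut; for c = 0 it is
  constant.\<close>

lemma continuous_on_csqrt_den:
  assumes "\<gamma> \<in> SL2"
  shows "continuous_on upper_half_plane (\<lambda>z. csqrt (den \<gamma> z))"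
proof (cases \<gamma>)
  case (fields a b c d)
  show ?thesis
  proof (cases "c = 0")
    case True
    then show ?thesis by (simp add: fields)
  next
    case False
    have "of_int c * z + of_int d \<notin> \<real>\<^sub>\<le>\<^sub>0" if "z \<in> upper_half_plane" for z
      using that False by (auto simp: complex_nonpos_Reals_iff upper_half_plane_def)
    then have "(\<lambda>z. csqrt (of_int c * z + of_int d)) holomorphic_on upper_half_plane"
      by (auto intro!: holomorphic_intros)
    then have "continuous_on upper_half_plane (\<lambda>z. csqrt (of_int c * z + of_int d))"
      by (rule holomorphic_on_imp_continuous_on)
    then show ?thesis by (simp add: fields)
  qed
qed

context multiplier
begin

lemma J_nonzero:
  assumes "\<gamma> \<in> Gamma0 N" "z \<in> upper_half_plane"
  shows "J \<gamma> z \<noteq> 0"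
proof -
  have "den \<gamma> z \<noteq> 0" using assms Gamma0_subset_SL2 den_nonzero by blast
  then show ?thesis using norm_J[OF assms(1), of z] by auto
qed

lemma continuous_on_J:
  assumes "\<gamma> \<in> SL2"
  shows "continuous_on upper_half_plane (J \<gamma>)"
proof (cases \<gamma>)
  case (fields a b c d)
  have "continuous_on upper_half_plane (\<lambda>z. \<nu> c d * csqrt (den \<gamma> z) ^ W)"
    by (intro continuous_intros continuous_on_csqrt_den[OF assms])
  then show ?thesis by (simp add: fields)
qed

text \<open>
  Both sides are the factor by which \<open>f\<close> transforms, so they agree wherever \<open>f\<close> does not vanish.
  This spares us quadratic reciprocity.
\<close>
lemma cocycle_of_nonzero_form:
  assumes hol: "f holomorphic_on upper_half_plane"
    and mod: "\<And>\<gamma> z. \<gamma> \<in> Gamma0 N \<Longrightarrow> z \<in> upper_half_plane \<Longrightarrow> f (act \<gamma> z) = J \<gamma> z * f z"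
    and nz: "z1 \<in> upper_half_plane" "f z1 \<noteq> 0"
    and \<gamma>: "\<gamma> \<in> Gamma0 N" and \<delta>: "\<delta> \<in> Gamma0 N" and z0: "z0 \<in> upper_half_plane"
  shows "J (mmul \<gamma> \<delta>) z0 = J \<gamma> (act \<delta> z0) * J \<delta> z0"
proof (rule ccontr)
  have sl: "\<gamma> \<in> SL2" "\<delta> \<in> SL2" "mmul \<gamma> \<delta> \<in> SL2" "mmul \<gamma> \<delta> \<in> Gamma0 N"
    using \<gamma> \<delta> Gamma0_subset_SL2 mmul_SL2 mmul_Gamma0 by blast+
  define D where "D = (\<lambda>z. J (mmul \<gamma> \<delta>) z - J \<gamma> (act \<delta> z) * J \<delta> z)"
  assume "J (mmul \<gamma> \<delta>) z0 \<noteq> J \<gamma> (act \<delta> z0) * J \<delta> z0"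
  then have D0: "D z0 \<noteq> 0" by (simp add: D_def)
  have "continuous_on upper_half_plane (\<lambda>z. J \<gamma> (act \<delta> z))"
    by (rule continuous_on_compose2[OF continuous_on_J[OF sl(1)]
          holomorphic_on_imp_continuous_on[OF holomorphic_act(1)[OF sl(2)]]])
       (use act_upper[OF sl(2)] in auto)
  \<comment> \<open>By continuity the cocycle defect \<open>D\<close> is nonzero on an open set.
    There \<open>f\<close> vanishes, so the identity theorem would make \<open>f\<close> zero
    everywhere.\<close>
  then have "continuous_on upper_half_plane D"
    unfolding D_def by (intro continuous_intros continuous_on_J sl)
  then have op: "open (upper_half_plane \<inter> D -` (- {0}))"
    using continuous_open_preimage[OF _ open_upper_half_plane, of D "- {0}"] by auto
  have f0: "f z = 0" if "z \<in> (upper_half_plane \<inter> D -` (- {0}))" for z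
  proof -
    have z: "z \<in> upper_half_plane" "D z \<noteq> 0" using that by auto
    have "J (mmul \<gamma> \<delta>) z * f z = f (act (mmul \<gamma> \<delta>) z)" using mod sl z by simp
    also have "\<dots> = f (act \<gamma> (act \<delta> z))" using sl z by (simp add: act_mmul)
    also have "\<dots> = J \<gamma> (act \<delta> z) * (J \<delta> z * f z)"
      using mod \<gamma> \<delta> z act_upper[OF sl(2) z(1)] by simp
    finally have "D z * f z = 0" by (simp add: D_def algebra_simps)
    then show ?thesis using z by simp
  qed
  have "f z1 = 0"
  proof (rule analytic_continuation_open[of "(upper_half_plane \<inter> D -` (- {0}))"
        upper_half_plane f "\<lambda>_. 0"])
    show "(upper_half_plane \<inter> D -` (- {0})) \<noteq> {}" using D0 z0 by auto
  qed (use op f0 hol nz open_upper_half_plane connected_upper_half_plane in auto)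
  with nz show False by simp
qed

end

section \<open>Cosets of level N p^2 in level N, and the trace\<close>

lemma solve_linear_cong:
  fixes m :: nat and x y :: int
  assumes "coprime x (int m)" "m > 0"
  obtains b :: nat where "b < m" "int m dvd x * int b - y"
proof -
  obtain u where u: "[x * u = 1] (mod int m)" using cong_solve_coprime_int[OF assms(1)] by blast
  define b where "b = nat ((u * y) mod int m)"
  have b: "int b = (u * y) mod int m" using assms by (simp add: b_def)
  have "[int b = u * y] (mod int m)" by (simp add: b cong_def)
  then have "[x * int b = x * (u * y)] (mod int m)" by (rule cong_scalar_left)
  also have "x * (u * y) = (x * u) * y" by simp
  also have "[(x * u) * y = 1 * y] (mod int m)" using u by (rule cong_scalar_right)
  finally have "int m dvd x * int b - y" by (simp add: cong_iff_dvd_diff)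
  moreover have "b < m" using assms b by (metis of_nat_less_iff pos_mod_bound of_nat_0_less_iff)
  ultimately show ?thesis using that by blast
qed

text \<open>\<open>bezout\<close> supplies a matrix of \<open>Gamma0 N\<close> with lower row (N,
  p^2) and makes \<open>p\<close> prime to \<open>N\<close>. \<open>nu_conj\<close> says that the
  multiplier survives conjugation by diag(p^2, 1), and \<open>cocycle\<close> makes a sum over
  cosets meaningful.\<close>

locale hecke_data = multiplier +
  fixes p :: nat and a0 b0 :: int
  assumes p: "prime p"
    and bezout: "a0 * (int p)\<^sup>2 - b0 * int N = 1"
    and nu_conj: "coprime (c * (int p)\<^sup>2) d \<Longrightarrow> int N dvd c \<Longrightarrow> \<nu> (c * (int p)\<^sup>2) d = \<nu> c d"
    and cocycle: "\<gamma> \<in> Gamma0 N \<Longrightarrow> \<delta> \<in> Gamma0 N \<Longrightarrow> z \<in> upper_half_plane \<Longrightarrow>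
      J (mmul \<gamma> \<delta>) z = J \<gamma> (act \<delta> z) * J \<delta> z"
begin

lemma p_pos: "p > 0" using p by (simp add: prime_gt_0_nat)

lemma prime_int_p: "prime (int p)" using p by simp

lemma p_not_dvd_N: "\<not> int p dvd int N"
proof
  assume "int p dvd int N"
  then have "int p dvd a0 * (int p)\<^sup>2 - b0 * int N"
    by (intro dvd_diff) (auto simp: power2_eq_square)
  then show False using prime_int_p by (simp add: bezout)
qed

lemma upper_scale: "z \<in> upper_half_plane \<Longrightarrow> of_nat (p\<^sup>2) * z \<in> upper_half_plane"
  using p_pos by (simp add: upper_half_plane_def del: of_nat_power)

abbreviation \<Gamma>p :: "mat set" where "\<Gamma>p \<equiv> Gamma0 (N * p\<^sup>2)"

lemma \<Gamma>p_subset: "\<Gamma>p \<subseteq> Gamma0 N"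
  by (auto simp: Gamma0_def intro: dvd_mult_left)

definition modular :: "(complex \<Rightarrow> complex) \<Rightarrow> bool" where
  "modular g \<longleftrightarrow> (\<forall>\<gamma>\<in>Gamma0 N. \<forall>z\<in>upper_half_plane. g (act \<gamma> z) = J \<gamma> z * g z)"

text \<open>The function g(p^2 z) slashed by \<sigma>; for modular \<open>g\<close> and \<sigma> in
  \<open>Gamma0 N\<close> it depends only on the coset of \<sigma>.\<close>

definition slash :: "(complex \<Rightarrow> complex) \<Rightarrow> mat \<Rightarrow> complex \<Rightarrow> complex" where
  "slash g \<sigma> z = g (of_nat (p\<^sup>2) * act \<sigma> z) / J \<sigma> z"

text \<open>Conjugation by diag(p^2, 1) takes \<open>\<delta>\<close> to a matrix \<gamma> of
  \<open>Gamma0 N\<close> whose lower left entry is c / p^2, and \<open>nu_conj\<close> identifies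
  the two factors.\<close>

lemma scaled_modular:
  assumes "modular g" "\<delta> \<in> \<Gamma>p" "u \<in> upper_half_plane"
  shows "g (of_nat (p\<^sup>2) * act \<delta> u) = J \<delta> u * g (of_nat (p\<^sup>2) * u)"
proof -
  obtain a b c d where eq: "\<delta> = (a, b, c, d)" by (cases \<delta>)
  have det: "a * d - b * c = 1" and "int (N * p\<^sup>2) dvd c" using assms by (auto simp: eq Gamma0_def)
  then obtain m where "c = int (N * p\<^sup>2) * m" by (elim dvdE)
  then have c: "c = (int N * m) * (int p)\<^sup>2" by simp
  define c' where "c' = int N * m"
  define \<gamma> :: mat where "\<gamma> = (a, b * (int p)\<^sup>2, c', d)"
  have \<gamma>: "\<gamma> \<in> Gamma0 N" using det by (simp add: \<gamma>_def Gamma0_def c c'_def mult_ac)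
  have "coprime c d" using Gamma0_lower_row(1) assms(2) by (simp add: eq)
  then have "\<nu> c d = \<nu> c' d"
    unfolding c c'_def by (intro nu_conj) auto
  then have "J \<gamma> (of_nat (p\<^sup>2) * u) = J \<delta> u"
    by (simp add: \<gamma>_def eq c c'_def mult_ac)
  moreover have "act \<gamma> (of_nat (p\<^sup>2) * u) = of_nat (p\<^sup>2) * act \<delta> u"
    by (simp add: \<gamma>_def eq c c'_def moebius_def algebra_simps)
  ultimately show ?thesis
    using assms \<gamma> upper_scale[OF assms(3)] by (metis modular_def)
qed

lemma slash_left_invariant:
  assumes g: "modular g" and \<delta>: "\<delta> \<in> \<Gamma>p" and \<sigma>: "\<sigma> \<in> Gamma0 N" and z: "z \<in> upper_half_plane"
  shows "slash g (mmul \<delta> \<sigma>) z = slash g \<sigma> z"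
proof -
  have \<delta>': "\<delta> \<in> Gamma0 N" using \<delta> \<Gamma>p_subset by blast
  have sl: "\<delta> \<in> SL2" "\<sigma> \<in> SL2" using \<delta>' \<sigma> Gamma0_subset_SL2 by blast+
  have u: "act \<sigma> z \<in> upper_half_plane" using act_upper sl z by blast
  show ?thesis
    using J_nonzero[OF \<delta>' u] scaled_modular[OF g \<delta> u] cocycle[OF \<delta>' \<sigma> z] act_mmul[OF sl z]
    by (simp add: slash_def)
qed

lemma slash_right:
  assumes "\<sigma> \<in> Gamma0 N" "\<gamma> \<in> Gamma0 N" "z \<in> upper_half_plane"
  shows "slash g \<sigma> (act \<gamma> z) = J \<gamma> z * slash g (mmul \<sigma> \<gamma>) z"
proof -
  have sl: "\<sigma> \<in> SL2" "\<gamma> \<in> SL2" using assms Gamma0_subset_SL2 by blast+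
  show ?thesis
    using J_nonzero[OF assms(2,3)] cocycle[OF assms] act_mmul[OF sl assms(3)]
    by (simp add: slash_def)
qed

text \<open>
  The cosets of \<open>\<Gamma>\<^sub>0(N p\<^sup>2)\<close> in \<open>\<Gamma>\<^sub>0(N)\<close> correspond to the points \<open>(c : d)\<close> of the projective line over
  \<open>\<int>/p\<^sup>2\<close>, where \<open>(N c, d)\<close> is the lower row: these are \<open>(0 : 1)\<close>, \<open>(p h : 1)\<close> and \<open>(1 : N b + p\<^sup>2)\<close>.
\<close>
definition rep_mid :: "nat \<Rightarrow> mat" where
  "rep_mid h = (1, 0, int N * (int p * int h), 1)"

text \<open>This is \<open>rep_top 0\<close> times the translation by b. As \<open>N\<close> is
  invertible modulo p^2, N b + p^2 runs through all residues.\<close>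

definition rep_top :: "nat \<Rightarrow> mat" where
  "rep_top b = (a0, a0 * int b + b0, int N * 1, int N * int b + (int p)\<^sup>2)"

text \<open>Writing \<open>int N * 0\<close>, as \<open>int N * 1\<close> above, gives all lower
  rows the shape used in \<open>mmul_minv_in_\<Gamma>p_iff\<close>.\<close>

definition reps :: "mat set" where
  "reps = insert (1, 0, int N * 0, 1) (rep_mid ` {1..<p} \<union> rep_top ` {..<p\<^sup>2})"

lemma finite_reps: "finite reps" by (simp add: reps_def)

lemma reps_subset: "reps \<subseteq> Gamma0 N"
  using bezout by (auto simp: reps_def rep_mid_def rep_top_def Gamma0_def algebra_simps)

text \<open>The lower left entry of the product is N (c d' - d c'), so the criterion is equality of
  (c : d) and (c' : d') on the projective line modulo p^2.\<close>

lemma mmul_minv_in_\<Gamma>p_iff: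
  assumes "(a, b, int N * c, d) \<in> Gamma0 N" "(a', b', int N * c', d') \<in> Gamma0 N"
  shows "mmul (a, b, int N * c, d) (minv (a', b', int N * c', d')) \<in> \<Gamma>p \<longleftrightarrow>
    (int p)\<^sup>2 dvd c * d' - d * c'"
proof -
  have "mmul (a, b, int N * c, d) (minv (a', b', int N * c', d')) \<in> Gamma0 N"
    using assms by (intro mmul_Gamma0 minv_Gamma0)
  then have "mmul (a, b, int N * c, d) (minv (a', b', int N * c', d')) \<in> \<Gamma>p \<longleftrightarrow>
      int N * (int p)\<^sup>2 dvd int N * (c * d' - d * c')"
    by (simp add: Gamma0_def algebra_simps)
  also have "\<dots> \<longleftrightarrow> (int p)\<^sup>2 dvd c * d' - d * c'"
    using N_pos by (subst dvd_mult_cancel_left) auto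
  finally show ?thesis .
qed

lemma rep_exists:
  assumes "\<sigma> \<in> Gamma0 N"
  shows "\<exists>r\<in>reps. mmul \<sigma> (minv r) \<in> \<Gamma>p"
proof -
  obtain a b c d where eq: "\<sigma> = (a, b, int N * c, d)"
    using assms by (cases \<sigma>) (auto simp: Gamma0_def elim!: dvdE)
  have \<sigma>: "(a, b, int N * c, d) \<in> Gamma0 N" using assms by (simp add: eq)
  have crit: "\<exists>r\<in>reps. mmul \<sigma> (minv r) \<in> \<Gamma>p"
    if "(a', b', int N * c', d') \<in> reps" "(int p)\<^sup>2 dvd c * d' - d * c'" for a' b' c' d'
    using that mmul_minv_in_\<Gamma>p_iff[OF \<sigma>, of a' b' c' d'] reps_subset unfolding eq by blast
  have copr: "coprime (int N * c) d" using Gamma0_lower_row(1)[OF \<sigma>] .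
  \<comment> \<open>The power of \<open>p\<close> in c selects the type of representative. If p
    divides c exactly once, d is invertible modulo p and d h = c' is solved there; if p does not
    divide c, c N b = d is solved modulo p^2.\<close>
  consider "(int p)\<^sup>2 dvd c" | c' where "c = int p * c'" "\<not> int p dvd c'" | "\<not> int p dvd c"
    by (metis dvdE mult_dvd_mono dvd_refl power2_eq_square)
  then show ?thesis
  proof cases
    case 1
    then show ?thesis by (intro crit[of 1 0 0 1]) (auto simp: reps_def)
  next
    case 2
    have "\<not> int p dvd d"
      using copr 2(1) prime_int_p by (metis coprime_common_divisor dvd_mult dvd_triv_left not_prime_unit)
    then have "coprime d (int p)"
      using prime_int_p by (metis coprime_commute prime_imp_coprime)
    then obtain h where h: "h < p" "int p dvd d * int h - c'"
      using solve_linear_cong[of d p c'] p_pos by auto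
    have "h \<noteq> 0" using h 2(2) by (metis diff_0 dvd_minus_iff mult_zero_right of_nat_0)
    then have "rep_mid h \<in> reps" using h by (auto simp: reps_def)
    moreover have "(int p)\<^sup>2 dvd c * 1 - d * (int p * int h)"
    proof -
      have "c * 1 - d * (int p * int h) = - (int p * (d * int h - c'))"
        using 2(1) by (simp add: algebra_simps)
      then show ?thesis using h(2) by (simp add: power2_eq_square del: minus_diff_eq)
    qed
    ultimately show ?thesis by (intro crit) (auto simp: rep_mid_def)
  next
    case 3
    have "\<not> int p dvd c * int N"
      using 3 p_not_dvd_N prime_int_p by (simp add: prime_dvd_mult_iff)
    then have "coprime (c * int N) (int p)"
      using prime_int_p by (metis coprime_commute prime_imp_coprime)
    then have "coprime (c * int N) (int (p\<^sup>2))" by simp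
    then obtain b where b: "b < p\<^sup>2" "int (p\<^sup>2) dvd c * int N * int b - d"
      using solve_linear_cong[of "c * int N" "p\<^sup>2" d] p_pos by auto
    then have "rep_top b \<in> reps" by (auto simp: reps_def)
    moreover have "(int p)\<^sup>2 dvd c * (int N * int b + (int p)\<^sup>2) - d * 1"
    proof -
      have "c * (int N * int b + (int p)\<^sup>2) - d * 1 = (c * int N * int b - d) + (int p)\<^sup>2 * c"
        by (simp add: algebra_simps)
      moreover have "(int p)\<^sup>2 dvd (c * int N * int b - d) + (int p)\<^sup>2 * c"
        using b(2) by (intro dvd_add) auto
      ultimately show ?thesis by (simp only:)
    qed
    ultimately show ?thesis unfolding rep_top_def by (rule crit)
  qed
qed

lemma p_sq_dvd_small:
  assumes "(int p)\<^sup>2 dvd int p * (int h - int h')" "h < p" "h' < p"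
  shows "h = h'"
proof -
  have "int p dvd int h - int h'" using assms(1) p_pos by (simp add: power2_eq_square)
  then have "[int h = int h'] (mod int p)" by (simp add: cong_iff_dvd_diff)
  then show ?thesis using assms by (simp add: cong_def)
qed

text \<open>The entries 0, p h and 1 are divisible by different powers of \<open>p\<close> up to
  p^2, so the three types do not mix; within a type the residue determines the index.\<close>

lemma rep_unique:
  assumes "r \<in> reps" "s \<in> reps" "mmul r (minv s) \<in> \<Gamma>p"
  shows "r = s"
proof -
  have not1: "\<not> (int p)\<^sup>2 dvd x" if "\<not> int p dvd x" for x
    using that by (metis dvd_mult_left power2_eq_square)
  have notp: "\<not> (int p)\<^sup>2 dvd int p * int h" if "h \<in> {1..<p}" for h
    using p_sq_dvd_small[of h 0] that p_pos by auto
  have p1: "\<not> int p dvd 1" using prime_gt_1_nat[OF p] by simp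
  have p2: "\<not> int p dvd int p * x - 1" for x
    using p1 dvd_diff[of "int p" "int p * x" "int p * x - 1"] by auto
  have p3: "\<not> int p dvd 1 - int p * x" for x
    using p1 dvd_add[of "int p" "1 - int p * x" "int p * x"] by auto
  have crit: "(int p)\<^sup>2 dvd c * d' - d * c'"
    if "r = (a, b, int N * c, d)" "s = (a', b', int N * c', d')" for a b c d a' b' c' d'
    using that assms reps_subset mmul_minv_in_\<Gamma>p_iff[of a b c d a' b' c' d'] by blast
  have top: "b = b'" if "(int p)\<^sup>2 dvd 1 * (int N * int b' + (int p)\<^sup>2) - (int N * int b + (int p)\<^sup>2) * 1"
      "b < p\<^sup>2" "b' < p\<^sup>2" for b b'
  proof -
    have "coprime (int p) (int N)"
      using p_not_dvd_N prime_int_p by (intro prime_imp_coprime)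
    then have "coprime (int (p\<^sup>2)) (int N)" by simp
    moreover have "int (p\<^sup>2) dvd int N * (int b' - int b)"
      using that(1) by (simp add: algebra_simps)
    ultimately have "int (p\<^sup>2) dvd int b' - int b"
      using coprime_dvd_mult_right_iff by blast
    then have "[int b' = int b] (mod int (p\<^sup>2))" by (simp add: cong_iff_dvd_diff)
    then have "[b' = b] (mod p\<^sup>2)" by (simp only: cong_int_iff)
    then show ?thesis using that by (simp add: cong_def)
  qed
  consider (o) "r = (1, 0, int N * 0, 1)" | (m) h where "h \<in> {1..<p}" "r = rep_mid h"
    | (t) b where "b < p\<^sup>2" "r = rep_top b" using assms(1) by (auto simp: reps_def)
  note r = this
  consider (o) "s = (1, 0, int N * 0, 1)" | (m) h where "h \<in> {1..<p}" "s = rep_mid h"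
    | (t) b where "b < p\<^sup>2" "s = rep_top b" using assms(2) by (auto simp: reps_def)
  note s = this
  show ?thesis
  proof (cases rule: r)
    case o: o
    show ?thesis
    proof (cases rule: s)
      case o then show ?thesis using \<open>r = _\<close> by simp
    next
      case (m h)
      then show ?thesis using crit[OF o(1) m(2)[unfolded rep_mid_def]] notp[of h] by simp
    next
      case (t b)
      then show ?thesis using crit[OF o(1) t(2)[unfolded rep_top_def]] not1[OF p1] by simp
    qed
  next
    case m: (m h)
    show ?thesis
    proof (cases rule: s)
      case o
      then show ?thesis using crit[OF m(2)[unfolded rep_mid_def] o(1)] notp[of h] m by simp
    next
      case (m h')
      have "(int p)\<^sup>2 dvd int p * (int h - int h')"
        using crit[OF \<open>r = rep_mid h\<close>[unfolded rep_mid_def] m(2)[unfolded rep_mid_def]]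
        by (simp add: algebra_simps)
      then show ?thesis using p_sq_dvd_small[of h h'] m \<open>r = rep_mid h\<close> \<open>h \<in> {1..<p}\<close> by simp
    next
      case (t b)
      have "(int p)\<^sup>2 dvd int p * (int h * (int N * int b + (int p)\<^sup>2)) - 1"
        using crit[OF m(2)[unfolded rep_mid_def] t(2)[unfolded rep_top_def]] by (simp add: mult_ac)
      then show ?thesis using not1[OF p2] by blast
    qed
  next
    case t: (t b)
    show ?thesis
    proof (cases rule: s)
      case o
      then show ?thesis using crit[OF t(2)[unfolded rep_top_def] o(1)] not1[OF p1] by simp
    next
      case (m h)
      have "(int p)\<^sup>2 dvd 1 - int p * (int h * (int N * int b + (int p)\<^sup>2))"
        using crit[OF t(2)[unfolded rep_top_def] m(2)[unfolded rep_mid_def]] by (simp add: mult_ac)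
      then show ?thesis using not1[OF p3] by blast
    next
      case (t b')
      then show ?thesis
        using crit[OF \<open>r = rep_top b\<close>[unfolded rep_top_def] t(2)[unfolded rep_top_def]]
          top[of b' b] \<open>b < p\<^sup>2\<close> \<open>r = rep_top b\<close> by simp
    qed
  qed
qed

definition hecke :: "(complex \<Rightarrow> complex) \<Rightarrow> complex \<Rightarrow> complex" where
  "hecke g z = (\<Sum>r\<in>reps. slash g r z)"

text \<open>Right multiplication by \<open>\<gamma>\<close> permutes the cosets;
  \<open>\<pi>\<close> is this permutation on the representatives.\<close>

lemma hecke_modular:
  assumes g: "modular g"
  shows "modular (hecke g)"
  unfolding modular_def
proof (intro ballI)
  fix \<gamma> z assume \<gamma>: "\<gamma> \<in> Gamma0 N" and z: "z \<in> upper_half_plane"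
  have rG: "r \<in> Gamma0 N" "mmul r \<gamma> \<in> Gamma0 N" if "r \<in> reps" for r
    using that reps_subset \<gamma> mmul_Gamma0 by blast+
  define \<pi> where "\<pi> = (\<lambda>r. SOME s. s \<in> reps \<and> mmul (mmul r \<gamma>) (minv s) \<in> \<Gamma>p)"
  have \<pi>: "\<pi> r \<in> reps \<and> mmul (mmul r \<gamma>) (minv (\<pi> r)) \<in> \<Gamma>p" if "r \<in> reps" for r
    unfolding \<pi>_def by (rule someI_ex) (use rep_exists[OF rG(2)[OF that]] in blast)
  have rSL: "s \<in> SL2" if "s \<in> Gamma0 N" for s using that Gamma0_subset_SL2 by blast
  have "inj_on \<pi> reps"
  proof (rule inj_onI)
    fix r s assume rs: "r \<in> reps" "s \<in> reps" "\<pi> r = \<pi> s"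
    define t where "t = \<pi> r"
    have t: "t \<in> SL2" using \<pi>[OF rs(1)] rG(1) rSL by (simp add: t_def)
    have "mmul (mmul r \<gamma>) (minv t) \<in> \<Gamma>p" "mmul (mmul s \<gamma>) (minv t) \<in> \<Gamma>p"
      using \<pi>[OF rs(1)] \<pi>[OF rs(2)] rs(3) by (auto simp: t_def)
    then have "mmul (mmul (mmul r \<gamma>) (minv t)) (minv (mmul (mmul s \<gamma>) (minv t))) \<in> \<Gamma>p"
      by (rule mmul_Gamma0[OF _ minv_Gamma0])
    also have "mmul (mmul (mmul r \<gamma>) (minv t)) (minv (mmul (mmul s \<gamma>) (minv t)))
        = mmul r (mmul (mmul \<gamma> (mmul (mmul (minv t) (minv (minv t))) (minv \<gamma>))) (minv s))"
      by (simp add: minv_mmul mmul_assoc)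
    also have "mmul (minv t) (minv (minv t)) = (1, 0, 0, 1)"
      using mmul_minv_right[OF minv_SL2[OF t]] .
    finally have "mmul r (minv s) \<in> \<Gamma>p"
      using mmul_minv_right[OF rSL[OF \<gamma>]] by (simp add: mmul_one)
    then show "r = s" using rep_unique rs by blast
  qed
  then have bij: "bij_betw \<pi> reps reps"
    using \<pi> finite_reps by (simp add: bij_betw_def endo_inj_surj image_subset_iff)
  have "hecke g (act \<gamma> z) = (\<Sum>r\<in>reps. J \<gamma> z * slash g (mmul r \<gamma>) z)"
    unfolding hecke_def by (intro sum.cong refl slash_right rG \<gamma> z)
  also have "\<dots> = (\<Sum>r\<in>reps. J \<gamma> z * slash g (\<pi> r) z)"
  proof (intro sum.cong refl)
    fix r assume r: "r \<in> reps"
    have "mmul r \<gamma> = mmul (mmul (mmul r \<gamma>) (minv (\<pi> r))) (\<pi> r)"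
      using mmul_minv_left[OF rSL[OF rG(1)]] \<pi>[OF r] by (simp add: mmul_assoc mmul_one)
    then show "J \<gamma> z * slash g (mmul r \<gamma>) z = J \<gamma> z * slash g (\<pi> r) z"
      using slash_left_invariant[OF g _ rG(1) z] \<pi>[OF r] by metis
  qed
  also have "\<dots> = J \<gamma> z * hecke g z"
    unfolding hecke_def sum_distrib_left[symmetric]
    using sum.reindex_bij_betw[OF bij, of "\<lambda>r. slash g r z"] by simp
  finally show "hecke g (act \<gamma> z) = J \<gamma> z * hecke g z" .
qed

text \<open>Each summand has invariant norm |g(p^2 u)| \<open>wt u\<close> with u = r z, and
  \<open>wt\<close> only grows when u is replaced by p^2 u.\<close>

lemma hecke_bounded:
  fixes S :: real
  assumes S: "\<And>z. z \<in> upper_half_plane \<Longrightarrow> norm (g z) * wt z \<le> S" and z: "z \<in> upper_half_plane"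
  shows "norm (hecke g z) * wt z \<le> card reps * S"
proof -
  have "norm (slash g r z) * wt z \<le> S" if "r \<in> reps" for r
  proof -
    have r: "r \<in> Gamma0 N" "r \<in> SL2" using that reps_subset Gamma0_subset_SL2 by blast+
    define u where "u = act r z"
    have u: "u \<in> upper_half_plane" using act_upper r z by (simp add: u_def)
    have "norm (slash g r z) * wt z = norm (g (of_nat (p\<^sup>2) * u)) * wt u"
      using r z by (simp add: slash_def u_def norm_divide norm_J wt_act)
    also have "wt u \<le> wt (of_nat (p\<^sup>2) * u)"
    proof -
      have "Im u * 1 \<le> Im u * real (p\<^sup>2)"
        using u p_pos by (intro mult_left_mono) (auto simp: upper_half_plane_def)
      then have "Im u \<le> Im (of_nat (p\<^sup>2) * u)" by (simp add: mult.commute)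
      then show ?thesis unfolding wt_def by (intro power_mono) (use u in \<open>auto simp: upper_half_plane_def\<close>)
    qed
    then have "norm (g (of_nat (p\<^sup>2) * u)) * wt u \<le> norm (g (of_nat (p\<^sup>2) * u)) * wt (of_nat (p\<^sup>2) * u)"
      by (intro mult_left_mono) auto
    also have "\<dots> \<le> S" by (rule S[OF upper_scale[OF u]])
    finally show ?thesis .
  qed
  then have "(\<Sum>r\<in>reps. norm (slash g r z) * wt z) \<le> (\<Sum>r\<in>reps. S)" by (rule sum_mono)
  moreover have "norm (hecke g z) * wt z \<le> (\<Sum>r\<in>reps. norm (slash g r z)) * wt z"
    unfolding hecke_def using wt_pos[OF z] by (intro mult_right_mono norm_sum) auto
  ultimately show ?thesis by (simp add: sum_distrib_right)
qed

end

section \<open>Fourier coefficients\<close>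

lemma has_sum_finite_sum:
  fixes f :: "'i \<Rightarrow> 'a \<Rightarrow> 'b::topological_comm_monoid_add"
  shows "finite I \<Longrightarrow> (\<And>i. i \<in> I \<Longrightarrow> (f i has_sum s i) A) \<Longrightarrow>
    ((\<lambda>x. \<Sum>i\<in>I. f i x) has_sum (\<Sum>i\<in>I. s i)) A"
  by (induction I rule: finite_induct) (auto intro!: has_sum_add)

lemma has_q_expansion_zero: "has_q_expansion (\<lambda>_. 0) (\<lambda>_. 0)"
  by (simp add: has_q_expansion_def has_sum_0)

lemma has_q_expansion_add:
  "has_q_expansion f a \<Longrightarrow> has_q_expansion g b \<Longrightarrow> has_q_expansion (\<lambda>z. f z + g z) (\<lambda>n. a n + b n)"
  by (auto simp: has_q_expansion_def distrib_right intro!: has_sum_add)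

lemma has_q_expansion_cmult:
  "has_q_expansion f a \<Longrightarrow> has_q_expansion (\<lambda>z. c * f z) (\<lambda>n. c * a n)"
  by (auto simp: has_q_expansion_def mult.assoc intro!: has_sum_cmult_right)

lemma has_q_expansion_sum:
  "finite I \<Longrightarrow> (\<And>i. i \<in> I \<Longrightarrow> has_q_expansion (f i) (a i)) \<Longrightarrow>
    has_q_expansion (\<lambda>z. \<Sum>i\<in>I. f i z) (\<lambda>n. \<Sum>i\<in>I. a i n)"
  by (induction I rule: finite_induct) (auto simp: has_q_expansion_zero intro!: has_q_expansion_add)

lemma has_q_expansion_cong:
  "(\<And>z. z \<in> upper_half_plane \<Longrightarrow> f z = g z) \<Longrightarrow> has_q_expansion f a \<longleftrightarrow> has_q_expansion g a"
  by (simp add: has_q_expansion_def)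

lemma qpar_power: "qpar z ^ n = qpar (of_nat n * z)"
  by (simp add: qpar_def flip: exp_of_nat_mult) (simp add: mult_ac)

lemma qpar_add: "qpar (z + w) = qpar z * qpar w"
  by (simp add: qpar_def distrib_left exp_add)

lemma norm_qpar_of_real: "norm (qpar (of_real t)) = 1"
  by (simp add: qpar_def)

lemma has_q_expansion_scale:
  assumes "has_q_expansion g a" "m > 0"
  shows "has_q_expansion (\<lambda>z. g (of_nat m * z)) (\<lambda>n. if m dvd n then a (n div m) else 0)"
  unfolding has_q_expansion_def
proof
  have inj: "inj ((*) m)" using assms(2) by (auto intro: injI)
  fix z assume "z \<in> upper_half_plane"
  then have "of_nat m * z \<in> upper_half_plane" using assms by (simp add: upper_half_plane_def)
  then have "((\<lambda>n. a n * qpar (of_nat m * z) ^ n) has_sum g (of_nat m * z)) UNIV"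
    using assms by (simp add: has_q_expansion_def)
  also have "(\<lambda>n. a n * qpar (of_nat m * z) ^ n) =
      (\<lambda>n. (if m dvd n then a (n div m) else 0) * qpar z ^ n) \<circ> (*) m"
    using assms(2) by (auto simp: fun_eq_iff qpar_power mult_ac)
  finally have "((\<lambda>n. (if m dvd n then a (n div m) else 0) * qpar z ^ n) has_sum g (of_nat m * z))
      (range ((*) m))"
    using assms(2) by (simp only: has_sum_reindex[OF inj])
  then show "((\<lambda>n. (if m dvd n then a (n div m) else 0) * qpar z ^ n) has_sum g (of_nat m * z)) UNIV"
    by (rule has_sum_cong_neutral[THEN iffD1, rotated -1]) (auto elim!: dvdE)
qed

lemma has_q_expansion_shift:
  assumes "has_q_expansion g a"
  shows "has_q_expansion (\<lambda>z. g (z + of_real t)) (\<lambda>n. qpar (of_real (real n * t)) * a n)"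
  unfolding has_q_expansion_def
proof
  fix z assume "z \<in> upper_half_plane"
  then have "z + of_real t \<in> upper_half_plane" by (simp add: upper_half_plane_def)
  then have "((\<lambda>n. a n * qpar (z + of_real t) ^ n) has_sum g (z + of_real t)) UNIV"
    using assms by (simp add: has_q_expansion_def)
  also have "(\<lambda>n. a n * qpar (z + of_real t) ^ n) =
      (\<lambda>n. qpar (of_real (real n * t)) * a n * qpar z ^ n)"
    by (simp add: fun_eq_iff power_mult_distrib qpar_add) (simp add: qpar_power)
  finally show "((\<lambda>n. qpar (of_real (real n * t)) * a n * qpar z ^ n) has_sum g (z + of_real t)) UNIV" .
qed

lemma sum_qpar_power:
  assumes "m > 0"
  shows "(\<Sum>b<m. qpar (of_nat n / of_nat m) ^ b) = (if m dvd n then of_nat m else 0)"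
proof -
  define x where "x = qpar (of_nat n / of_nat m)"
  have "x = exp (2 * of_real pi * \<i> * of_nat n / of_nat m)"
    by (simp add: x_def qpar_def)
  then have x1: "x = 1 \<longleftrightarrow> m dvd n"
    using complex_root_unity_eq[of m n 0] assms by (simp add: dvd_eq_mod_eq_0)
  have "x ^ m = 1"
    using assms exp_two_pi_i[THEN arg_cong, of "\<lambda>u. u ^ n"]
    by (simp add: x_def qpar_power) (simp add: qpar_def flip: exp_of_nat_mult, simp add: mult_ac)
  then show ?thesis
    using x1 geometric_sum[of x m] by (auto simp: x_def[symmetric])
qed

text \<open>Summing over the shifts by b/m leaves only exponents divisible by \<open>m\<close>, by
  orthogonality of roots of unity.\<close>

lemma has_q_expansion_U:
  assumes "has_q_expansion g a" "m > 0"
  shows "has_q_expansion (\<lambda>z. \<Sum>b<m. g ((z + of_nat b) / of_nat m)) (\<lambda>n. of_nat m * a (m * n))"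
  unfolding has_q_expansion_def
proof
  have inj: "inj ((*) m)" using assms(2) by (auto intro: injI)
  fix z assume z: "z \<in> upper_half_plane"
  define u where "u = z / of_nat m"
  have "((\<lambda>n. a n * qpar u ^ n * qpar (of_nat n / of_nat m) ^ b) has_sum
      g ((z + of_nat b) / of_nat m)) UNIV" for b
  proof -
    have "(z + of_nat b) / of_nat m \<in> upper_half_plane"
      using z assms(2) by (simp add: upper_half_plane_def)
    then have "((\<lambda>n. a n * qpar ((z + of_nat b) / of_nat m) ^ n) has_sum
        g ((z + of_nat b) / of_nat m)) UNIV"
      using assms(1) unfolding has_q_expansion_def by blast
    moreover have "qpar ((z + of_nat b) / of_nat m) ^ n = qpar u ^ n * qpar (of_nat n / of_nat m) ^ b" for n
      by (simp add: u_def add_divide_distrib power_mult_distrib qpar_add) (simp add: qpar_power mult_ac)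
    ultimately show ?thesis by (simp add: mult_ac)
  qed
  then have "((\<lambda>n. \<Sum>b<m. a n * qpar u ^ n * qpar (of_nat n / of_nat m) ^ b) has_sum
      (\<Sum>b<m. g ((z + of_nat b) / of_nat m))) UNIV"
    by (intro has_sum_finite_sum) auto
  then have "((\<lambda>n. a n * qpar u ^ n * (if m dvd n then of_nat m else 0)) has_sum
      (\<Sum>b<m. g ((z + of_nat b) / of_nat m))) UNIV"
    by (simp add: sum_qpar_power[OF assms(2)] flip: sum_distrib_left)
  then have "((\<lambda>n. a n * qpar u ^ n * (if m dvd n then of_nat m else 0)) has_sum
      (\<Sum>b<m. g ((z + of_nat b) / of_nat m))) (range ((*) m))"
    by (rule has_sum_cong_neutral[THEN iffD1, rotated -1]) (auto elim!: dvdE)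
  then have "((\<lambda>n. a n * qpar u ^ n * (if m dvd n then of_nat m else 0)) \<circ> (*) m has_sum
      (\<Sum>b<m. g ((z + of_nat b) / of_nat m))) UNIV"
    by (simp only: has_sum_reindex[OF inj])
  moreover have "(\<lambda>n. a n * qpar u ^ n * (if m dvd n then of_nat m else 0)) \<circ> (*) m
      = (\<lambda>n. of_nat m * a (m * n) * qpar z ^ n)"
    using assms(2) by (auto simp: fun_eq_iff qpar_power u_def)
  ultimately show "((\<lambda>n. of_nat m * a (m * n) * qpar z ^ n) has_sum
      (\<Sum>b<m. g ((z + of_nat b) / of_nat m))) UNIV"
    by simp
qed

section \<open>Linear combinations of forms\<close>

context multiplier
begin

lemma forms_zero: "(\<lambda>_. 0) \<in> forms"
  by (auto simp: forms_def)

lemma forms_linear: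
  assumes "g \<in> forms" "h \<in> forms"
  shows "(\<lambda>z. c * g z + h z) \<in> forms"
proof -
  obtain S S' where S: "\<And>z. z \<in> upper_half_plane \<Longrightarrow> norm (g z) * wt z \<le> S"
      "\<And>z. z \<in> upper_half_plane \<Longrightarrow> norm (h z) * wt z \<le> S'"
    using assms unfolding forms_def by blast
  have "norm (c * g z + h z) * wt z \<le> norm c * S + S'" if "z \<in> upper_half_plane" for z
  proof -
    have "norm (c * g z + h z) * wt z \<le> (norm (c * g z) + norm (h z)) * wt z"
      using wt_pos[OF that] by (intro mult_right_mono norm_triangle_ineq) auto
    also have "\<dots> = norm c * (norm (g z) * wt z) + norm (h z) * wt z"
      by (simp add: norm_mult algebra_simps)
    also have "\<dots> \<le> norm c * S + S'"
      using S[OF that] by (intro add_mono mult_left_mono) auto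
    finally show ?thesis .
  qed
  then have "\<exists>S. \<forall>z\<in>upper_half_plane. norm (c * g z + h z) * wt z \<le> S" by blast
  then show ?thesis
    using assms by (auto simp: forms_def algebra_simps intro!: holomorphic_intros)
qed

lemma forms_sum:
  "finite I \<Longrightarrow> (\<And>i. i \<in> I \<Longrightarrow> g i \<in> forms) \<Longrightarrow> (\<lambda>z. \<Sum>i\<in>I. c i * g i z) \<in> forms"
  by (induction I rule: finite_induct) (auto simp: forms_zero forms_linear)

end

section \<open>The trace on Fourier expansions\<close>

context hecke_data
begin

text \<open>With \<beta> inverse to N h modulo p, diag(p^2, 1) \<open>rep_mid h\<close> equals
  \<gamma> times the upper triangular matrix with rows (p, \<beta>) and (0, p), where \<gamma> lies
  in \<open>Gamma0 N\<close>. The triangular matrix is the shift by \<beta>/p; the scaling of the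
  denominator by 1/p gives the size of \<open>B\<close>.\<close>

lemma slash_rep_mid:
  assumes h: "h \<in> {1..<p}"
  shows "\<exists>B (\<beta>::nat). norm B = (1 / sqrt p) ^ W \<and>
    (\<forall>g z. modular g \<longrightarrow> z \<in> upper_half_plane \<longrightarrow>
      slash g (rep_mid h) z = B * g (z + of_real (real \<beta> / real p)))"
proof -
  have "\<not> int p dvd int h" using h by (auto dest: zdvd_imp_le)
  then have "\<not> int p dvd int N * int h"
    using p_not_dvd_N prime_int_p by (simp add: prime_dvd_mult_iff)
  then have "coprime (int N * int h) (int p)"
    using prime_int_p by (metis coprime_commute prime_imp_coprime)
  then obtain \<beta> where "int p dvd (int N * int h) * int \<beta> - 1"
    using solve_linear_cong[of "int N * int h" p 1] p_pos by auto
  then obtain m where "int N * int h * int \<beta> - 1 = int p * m" by (elim dvdE)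
  then have d': "1 - int N * int h * int \<beta> = int p * - m" by simp
  define d' where "d' = - m"
  have d': "int p * d' + int N * int h * int \<beta> = 1" using d' by (simp add: d'_def)
  define \<gamma> :: mat where "\<gamma> = (int p, - int \<beta>, int N * int h, d')"
  have \<gamma>: "\<gamma> \<in> Gamma0 N" using d' by (simp add: \<gamma>_def Gamma0_def algebra_simps)
  have r: "rep_mid h \<in> Gamma0 N" using h reps_subset by (auto simp: reps_def)
  define B where "B = \<nu> (int N * int h) d' / \<nu> (int N * (int p * int h)) 1 * of_real (sqrt (1 / p)) ^ W"
  have n1: "norm (\<nu> (int N * int h) d') = 1"
    using Gamma0_lower_row[of "int p" "- int \<beta>" "int N * int h" d' N] \<gamma> norm_nu by (simp add: \<gamma>_def)
  have n2: "norm (\<nu> (int N * (int p * int h)) 1) = 1"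
    by (rule norm_nu) auto
  have "norm B = (1 / sqrt p) ^ W"
    by (simp add: B_def norm_mult norm_divide norm_power n1 n2 real_sqrt_divide)
  moreover have "slash g (rep_mid h) z = B * g (z + of_real (real \<beta> / real p))"
    if g: "modular g" and z: "z \<in> upper_half_plane" for g z
  proof -
    define w where "w = z + of_real (real \<beta> / real p)"
    have w: "w \<in> upper_half_plane" using z by (simp add: w_def upper_half_plane_def)
    define D where "D = den (rep_mid h) z"
    have D: "D \<noteq> 0" using den_nonzero r Gamma0_subset_SL2 z unfolding D_def by blast
    have pz: "(of_nat p :: complex) \<noteq> 0" using p_pos by simp
    have d'': "of_nat p * of_int d' + of_nat N * of_nat h * of_nat \<beta> = (1 :: complex)"
      using arg_cong[OF d', of "of_int :: int \<Rightarrow> complex"] by simp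
    have "of_nat p * den \<gamma> w = of_nat N * of_nat h * (of_nat p * z)
        + (of_nat p * of_int d' + of_nat N * of_nat h * of_nat \<beta>)"
      using pz by (simp add: \<gamma>_def w_def field_simps)
    also have "\<dots> = D" unfolding d'' by (simp add: D_def rep_mid_def)
    finally have pD: "of_nat p * den \<gamma> w = D" .
    then have den: "den \<gamma> w = of_real (1 / p) * D"
      using pz by (simp add: field_simps)
    have "act \<gamma> w = (of_nat p * z) / den \<gamma> w"
      using pz by (simp add: \<gamma>_def moebius_def w_def field_simps)
    also have "\<dots> = of_nat (p\<^sup>2) * (z / D)"
      using pz D unfolding den by (simp add: field_simps power2_eq_square)
    also have "z / D = act (rep_mid h) z" by (simp add: D_def rep_mid_def moebius_def)
    finally have act: "of_nat (p\<^sup>2) * act (rep_mid h) z = act \<gamma> w" ..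
    have J1: "J \<gamma> w = \<nu> (int N * int h) d' * (of_real (sqrt (1 / p)) ^ W * csqrt D ^ W)"
    proof -
      have "J \<gamma> w = \<nu> (int N * int h) d' * csqrt (den \<gamma> w) ^ W" by (simp add: \<gamma>_def)
      also have "csqrt (den \<gamma> w) = of_real (sqrt (1 / p)) * csqrt D"
        unfolding den using p_pos by (intro csqrt_of_real_mult) simp
      finally show ?thesis by (simp only: power_mult_distrib)
    qed
    have J2: "J (rep_mid h) z = \<nu> (int N * (int p * int h)) 1 * csqrt D ^ W"
      by (simp add: D_def rep_mid_def)
    have "slash g (rep_mid h) z = J \<gamma> w * g w / J (rep_mid h) z"
      unfolding slash_def act using g \<gamma> w by (simp add: modular_def)
    also have "\<dots> = B * g w"
      unfolding J1 J2 B_def using D n2 by (auto simp: field_simps)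
    finally show ?thesis by (simp add: w_def)
  qed
  ultimately show ?thesis by blast
qed

text \<open>Here diag(p^2, 1) \<open>rep_top 0\<close> equals \<gamma> diag(1, p^2) with \<gamma> in
  \<open>Gamma0 N\<close>. The denominator is scaled by 1/p^2, whose root is 1/p. The constant is
  the same for all b since translations have factor 1.\<close>

lemma slash_rep_top:
  "\<exists>C. norm C = (1 / p) ^ W \<and>
    (\<forall>g z b. modular g \<longrightarrow> z \<in> upper_half_plane \<longrightarrow>
      slash g (rep_top b) z = C * g ((z + of_nat b) / of_nat (p\<^sup>2)))"
proof -
  define \<gamma> :: mat where "\<gamma> = (a0 * (int p)\<^sup>2, b0, int N, 1)"
  have \<gamma>: "\<gamma> \<in> Gamma0 N" using bezout by (simp add: \<gamma>_def Gamma0_def)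
  have top: "rep_top b \<in> Gamma0 N" for b
    using bezout by (simp add: rep_top_def Gamma0_def algebra_simps)
  define C where "C = \<nu> (int N) 1 / \<nu> (int N) ((int p)\<^sup>2) * of_real (1 / p) ^ W"
  have n1: "norm (\<nu> (int N) 1) = 1" by (rule norm_nu) auto
  have n2: "norm (\<nu> (int N) ((int p)\<^sup>2)) = 1"
    using Gamma0_lower_row[of a0 b0 "int N" "(int p)\<^sup>2" N] top[of 0] norm_nu by (simp add: rep_top_def)
  have pz: "(of_nat p :: complex) \<noteq> 0" using p_pos by simp
  have base: "slash g (rep_top 0) w = C * g (w / of_nat (p\<^sup>2))"
    if g: "modular g" and w: "w \<in> upper_half_plane" for g w
  proof -
    define v where "v = w / of_nat (p\<^sup>2)"
    have v: "v \<in> upper_half_plane" using w p_pos by (simp add: v_def upper_half_plane_def del: of_nat_power)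
    define D where "D = den (rep_top 0) w"
    have D: "D \<noteq> 0" using den_nonzero top[of 0] Gamma0_subset_SL2 w unfolding D_def by blast
    have den: "den \<gamma> v = of_real ((1 / p)\<^sup>2) * D"
      using pz by (simp add: \<gamma>_def v_def D_def rep_top_def field_simps)
    have "act \<gamma> v = (of_int a0 * w + of_int b0) / den \<gamma> v"
      using pz by (simp add: \<gamma>_def moebius_def v_def)
    also have "\<dots> = of_nat (p\<^sup>2) * ((of_int a0 * w + of_int b0) / D)"
      using pz D unfolding den by (simp add: field_simps)
    also have "(of_int a0 * w + of_int b0) / D = act (rep_top 0) w"
      by (simp add: D_def rep_top_def moebius_def)
    finally have act: "of_nat (p\<^sup>2) * act (rep_top 0) w = act \<gamma> v" ..
    have J1: "J \<gamma> v = \<nu> (int N) 1 * (of_real (1 / p) ^ W * csqrt D ^ W)"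
    proof -
      have "J \<gamma> v = \<nu> (int N) 1 * csqrt (den \<gamma> v) ^ W" by (simp add: \<gamma>_def)
      also have "csqrt (den \<gamma> v) = of_real (sqrt ((1 / p)\<^sup>2)) * csqrt D"
        unfolding den using p_pos by (intro csqrt_of_real_mult) simp
      also have "sqrt ((1 / p)\<^sup>2) = 1 / p" by (simp add: real_sqrt_divide)
      finally show ?thesis by (simp only: power_mult_distrib)
    qed
    have J2: "J (rep_top 0) w = \<nu> (int N) ((int p)\<^sup>2) * csqrt D ^ W"
      by (simp add: D_def rep_top_def)
    have "slash g (rep_top 0) w = J \<gamma> v * g v / J (rep_top 0) w"
      unfolding slash_def act using g \<gamma> v by (simp add: modular_def)
    also have "\<dots> = C * g v"
      unfolding J1 J2 C_def using D n2 by (auto simp: field_simps)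
    finally show ?thesis by (simp add: v_def)
  qed
  have "slash g (rep_top b) z = C * g ((z + of_nat b) / of_nat (p\<^sup>2))"
    if g: "modular g" and z: "z \<in> upper_half_plane" for g z b
  proof -
    define t :: mat where "t = (1, int b, 0, 1)"
    have t: "t \<in> Gamma0 N" "act t z = z + of_nat b" "J t z = 1"
      by (auto simp: t_def Gamma0_def moebius_def nu_one)
    have "rep_top b = mmul (rep_top 0) t" by (simp add: rep_top_def t_def)
    then have "slash g (rep_top b) z = slash g (rep_top 0) (z + of_nat b)"
      using slash_right[OF top[of 0] t(1) z, of g] t by simp
    moreover have "z + of_nat b \<in> upper_half_plane" using z by (simp add: upper_half_plane_def)
    ultimately show ?thesis using base[OF g] by simp
  qed
  moreover have "norm C = (1 / p) ^ W"
    by (simp add: C_def norm_mult norm_divide norm_power n1 n2)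
  ultimately show ?thesis by blast
qed

lemma sum_reps:
  "(\<Sum>r\<in>reps. F r) = F (1, 0, 0, 1) + (\<Sum>h\<in>{1..<p}. F (rep_mid h)) + (\<Sum>b<p\<^sup>2. F (rep_top b))"
  for F :: "mat \<Rightarrow> complex"
proof -
  have inj: "inj_on rep_mid {1..<p}" "inj_on rep_top {..<p\<^sup>2}"
    using N_pos p_pos by (auto intro!: inj_onI simp: rep_mid_def rep_top_def)
  have ph: "int p * int h \<noteq> 1" for h
    using prime_gt_1_nat[OF p] by (auto simp: zmult_eq_1_iff)
  then have disj: "rep_mid ` {1..<p} \<inter> rep_top ` {..<p\<^sup>2} = {}"
    using N_pos by (auto simp: rep_mid_def rep_top_def)
  have no: "(1, 0, int N * 0, 1) \<notin> rep_mid ` {1..<p} \<union> rep_top ` {..<p\<^sup>2}"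
    using N_pos p_pos by (auto simp: rep_mid_def rep_top_def)
  show ?thesis
    unfolding reps_def using no disj inj
    by (simp add: sum.union_disjoint sum.reindex algebra_simps)
qed

text \<open>The constants do not depend on \<open>g\<close>, so the formula can be iterated.\<close>

lemma hecke_explicit:
  obtains B :: "nat \<Rightarrow> complex" and \<beta> :: "nat \<Rightarrow> nat" and C :: complex
  where "\<And>h. h \<in> {1..<p} \<Longrightarrow> norm (B h) = (1 / sqrt p) ^ W" "norm C = (1 / p) ^ W"
    "\<And>g z. modular g \<Longrightarrow> z \<in> upper_half_plane \<Longrightarrow>
      hecke g z = g (of_nat (p\<^sup>2) * z) + (\<Sum>h\<in>{1..<p}. B h * g (z + of_real (real (\<beta> h) / real p)))
        + C * (\<Sum>b<p\<^sup>2. g ((z + of_nat b) / of_nat (p\<^sup>2)))"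
proof -
  obtain B \<beta> where B: "\<And>h. h \<in> {1..<p} \<Longrightarrow> norm (B h) = (1 / sqrt p) ^ W"
      "\<And>h g z. h \<in> {1..<p} \<Longrightarrow> modular g \<Longrightarrow> z \<in> upper_half_plane \<Longrightarrow>
        slash g (rep_mid h) z = B h * g (z + of_real (real (\<beta> h) / real p))"
    using slash_rep_mid by metis
  obtain C where C: "norm C = (1 / p) ^ W" "\<And>g z b. modular g \<Longrightarrow> z \<in> upper_half_plane \<Longrightarrow>
      slash g (rep_top b) z = C * g ((z + of_nat b) / of_nat (p\<^sup>2))"
    using slash_rep_top by metis
  show ?thesis
  proof (rule that[of B C \<beta>])
    fix g z assume gz: "modular g" "z \<in> upper_half_plane"
    have "slash g (1, 0, 0, 1) z = g (of_nat (p\<^sup>2) * z)"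
      by (simp add: slash_def moebius_def nu_one)
    moreover have "(\<Sum>h\<in>{1..<p}. slash g (rep_mid h) z)
        = (\<Sum>h\<in>{1..<p}. B h * g (z + of_real (real (\<beta> h) / real p)))"
      by (intro sum.cong refl B(2) gz)
    moreover have "(\<Sum>b<p\<^sup>2. slash g (rep_top b) z)
        = C * (\<Sum>b<p\<^sup>2. g ((z + of_nat b) / of_nat (p\<^sup>2)))"
      unfolding sum_distrib_left by (intro sum.cong refl C(2) gz)
    ultimately show "hecke g z = g (of_nat (p\<^sup>2) * z)
        + (\<Sum>h\<in>{1..<p}. B h * g (z + of_real (real (\<beta> h) / real p)))
        + C * (\<Sum>b<p\<^sup>2. g ((z + of_nat b) / of_nat (p\<^sup>2)))"
      unfolding hecke_def sum_reps by simp
  qed (use B C in auto)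
qed

lemma hecke_holomorphic:
  assumes g: "modular g" and hol: "g holomorphic_on upper_half_plane"
  shows "hecke g holomorphic_on upper_half_plane"
proof -
  obtain B \<beta> C where "\<And>h. h \<in> {1..<p} \<Longrightarrow> norm (B h) = (1 / sqrt p) ^ W" "norm C = (1 / p) ^ W"
    and ex: "\<And>g z. modular g \<Longrightarrow> z \<in> upper_half_plane \<Longrightarrow>
      hecke g z = g (of_nat (p\<^sup>2) * z) + (\<Sum>h\<in>{1..<p}. B h * g (z + of_real (real (\<beta> h) / real p)))
        + C * (\<Sum>b<p\<^sup>2. g ((z + of_nat b) / of_nat (p\<^sup>2)))"
    by (rule hecke_explicit) (rule that)
  have comp: "(\<lambda>z. g (\<phi> z)) holomorphic_on upper_half_plane"
    if "\<phi> holomorphic_on upper_half_plane" "\<And>z. z \<in> upper_half_plane \<Longrightarrow> \<phi> z \<in> upper_half_plane" for \<phi>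
    by (rule holomorphic_on_compose_gen[OF that(1) hol, unfolded o_def]) (use that(2) in auto)
  have "(\<lambda>z. g (of_nat (p\<^sup>2) * z) + (\<Sum>h\<in>{1..<p}. B h * g (z + of_real (real (\<beta> h) / real p)))
        + C * (\<Sum>b<p\<^sup>2. g ((z + of_nat b) / of_nat (p\<^sup>2)))) holomorphic_on upper_half_plane"
    using p_pos by (intro holomorphic_intros comp)
      (auto simp: upper_half_plane_def simp del: of_nat_power)
  then show ?thesis by (rule holomorphic_transform) (simp only: ex[OF g])
qed

lemma hecke_forms:
  assumes "g \<in> forms"
  shows "hecke g \<in> forms"
proof -
  have g: "modular g" "g holomorphic_on upper_half_plane"
    using assms by (auto simp: forms_def modular_def)
  obtain S where "\<And>z. z \<in> upper_half_plane \<Longrightarrow> norm (g z) * wt z \<le> S"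
    using assms by (auto simp: forms_def)
  from hecke_bounded[OF this]
  have "\<exists>S. \<forall>z\<in>upper_half_plane. norm (hecke g z) * wt z \<le> S" by blast
  then show ?thesis
    using hecke_modular[OF g(1)] hecke_holomorphic[OF g] by (simp add: forms_def modular_def)
qed

text \<open>\<open>e n\<close> is an exponential sum over the middle representatives: p - 1 terms of
  equal modulus, whose exponentials all become 1 when p divides n. The factor p^2 in front of
  \<open>C\<close> counts the top representatives.\<close>

lemma hecke_q_expansion:
  obtains e :: "nat \<Rightarrow> complex" and C :: complex
  where "norm C = (1 / p) ^ W" "\<And>n. norm (e n) \<le> (real p - 1) * (1 / sqrt p) ^ W"
    "\<And>n. p dvd n \<Longrightarrow> e n = e 0"
    "\<And>g a. modular g \<Longrightarrow> has_q_expansion g a \<Longrightarrow>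
      has_q_expansion (hecke g) (\<lambda>n. (if p\<^sup>2 dvd n then a (n div p\<^sup>2) else 0) + e n * a n
        + of_nat (p\<^sup>2) * C * a (p\<^sup>2 * n))"
proof -
  obtain B \<beta> C where B: "\<And>h. h \<in> {1..<p} \<Longrightarrow> norm (B h) = (1 / sqrt p) ^ W"
    and C: "norm C = (1 / p) ^ W" and ex: "\<And>g z. modular g \<Longrightarrow> z \<in> upper_half_plane \<Longrightarrow>
      hecke g z = g (of_nat (p\<^sup>2) * z) + (\<Sum>h\<in>{1..<p}. B h * g (z + of_real (real (\<beta> h) / real p)))
        + C * (\<Sum>b<p\<^sup>2. g ((z + of_nat b) / of_nat (p\<^sup>2)))"
    by (rule hecke_explicit) (rule that)
  define e where "e = (\<lambda>n. \<Sum>h\<in>{1..<p}. B h * qpar (of_real (real n * (real (\<beta> h) / real p))))"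
  show ?thesis
  proof (rule that[OF C, of e])
    show "norm (e n) \<le> (real p - 1) * (1 / sqrt p) ^ W" for n
    proof -
      have "norm (e n) \<le> (\<Sum>h\<in>{1..<p}. (1 / sqrt p) ^ W)"
        unfolding e_def by (rule sum_norm_le) (simp add: norm_mult B norm_qpar_of_real del: of_real_mult of_real_divide)
      also have "\<dots> = (real p - 1) * (1 / sqrt p) ^ W" using p_pos by simp
      finally show ?thesis .
    qed
    show "e n = e 0" if n: "p dvd n" for n
    proof -
      obtain m where m: "n = p * m" using n by (elim dvdE)
      have "qpar (of_real (real n * (real b / real p))) = 1" for b
      proof -
        have "real n * (real b / real p) = real (m * b)" using p_pos by (simp add: m)
        then have "qpar (of_real (real n * (real b / real p))) = qpar 1 ^ (m * b)"
          by (simp only: qpar_power) simp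
        then show ?thesis by (simp add: qpar_def)
      qed
      moreover have "qpar (of_real (real 0 * (real b / real p))) = 1" for b
        by (simp add: qpar_def)
      ultimately show ?thesis by (simp only: e_def)
    qed
    fix g a assume g: "modular g" and a: "has_q_expansion g a"
    have "has_q_expansion (\<lambda>z. g (of_nat (p\<^sup>2) * z)
        + (\<Sum>h\<in>{1..<p}. B h * g (z + of_real (real (\<beta> h) / real p)))
        + C * (\<Sum>b<p\<^sup>2. g ((z + of_nat b) / of_nat (p\<^sup>2))))
      (\<lambda>n. (if p\<^sup>2 dvd n then a (n div p\<^sup>2) else 0)
        + (\<Sum>h\<in>{1..<p}. B h * (qpar (of_real (real n * (real (\<beta> h) / real p))) * a n))
        + C * (of_nat (p\<^sup>2) * a (p\<^sup>2 * n)))"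
      using p_pos by (intro has_q_expansion_add has_q_expansion_cmult has_q_expansion_sum
          has_q_expansion_scale has_q_expansion_shift has_q_expansion_U a) auto
    then have "has_q_expansion (hecke g) (\<lambda>n. (if p\<^sup>2 dvd n then a (n div p\<^sup>2) else 0)
        + (\<Sum>h\<in>{1..<p}. B h * (qpar (of_real (real n * (real (\<beta> h) / real p))) * a n))
        + C * (of_nat (p\<^sup>2) * a (p\<^sup>2 * n)))"
      using has_q_expansion_cong[OF ex[OF g]] by simp
    moreover have "(\<Sum>h\<in>{1..<p}. B h * (qpar (of_real (real n * (real (\<beta> h) / real p))) * a n)) = e n * a n" for n
      by (simp only: e_def sum_distrib_right mult.assoc)
    ultimately show "has_q_expansion (hecke g) (\<lambda>n. (if p\<^sup>2 dvd n then a (n div p\<^sup>2) else 0) + e n * a n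
        + of_nat (p\<^sup>2) * C * a (p\<^sup>2 * n))"
      by (simp add: mult_ac)
  qed
qed

text \<open>A polynomial relation between \<open>f\<close> and its iterated traces restricts to the
  coefficients of a single tower, where it becomes a relation for the tridiagonal operator on a
  bounded sequence.\<close>

theorem bounded_p_tower_eq_0:
  assumes f: "f \<in> forms" and a: "has_q_expansion f a"
    and W: "W \<ge> 3" and p5: "p \<ge> 5" and n0: "\<not> p\<^sup>2 dvd n0"
    and bd: "\<And>j. norm (a (n0 * (p\<^sup>2) ^ j)) \<le> Bd"
  shows "a (n0 * (p\<^sup>2) ^ j) = 0"
proof -
  obtain e C where C: "norm C = (1 / p) ^ W" and e: "\<And>n. norm (e n) \<le> (real p - 1) * (1 / sqrt p) ^ W"
    and e0: "\<And>n. p dvd n \<Longrightarrow> e n = e 0"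
    and ex: "\<And>g a. modular g \<Longrightarrow> has_q_expansion g a \<Longrightarrow>
      has_q_expansion (hecke g) (\<lambda>n. (if p\<^sup>2 dvd n then a (n div p\<^sup>2) else 0) + e n * a n
        + of_nat (p\<^sup>2) * C * a (p\<^sup>2 * n))"
    by (rule hecke_q_expansion) (rule that)
  define T where "T = (\<lambda>a n. (if p\<^sup>2 dvd n then a (n div p\<^sup>2) else 0) + e n * a n
        + of_nat (p\<^sup>2) * C * a (p\<^sup>2 * n))"
  have T: "T b n = (if p\<^sup>2 dvd n then b (n div p\<^sup>2) else 0) + e n * b n
        + of_nat (p\<^sup>2) * C * b (p\<^sup>2 * n)" for b n
    by (simp add: T_def)
  have exT: "has_q_expansion (hecke g) (T b)" if "modular g" "has_q_expansion g b" for g b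
    unfolding T_def using that by (rule ex)
  define D where "D = of_nat (p\<^sup>2) * C"
  have iter: "(hecke ^^ r) f \<in> forms" "has_q_expansion ((hecke ^^ r) f) ((T ^^ r) a)" for r
  proof (induction r)
    case (Suc r)
    { case 1 then show ?case using Suc by (simp add: hecke_forms) }
    { case 2
      have "modular ((hecke ^^ r) f)" using Suc(1) by (simp add: forms_def modular_def)
      from exT[OF this Suc(2)] show ?case by simp }
  qed (use f a in auto)
  \<comment> \<open>The tower is closed under the operator: \<open>n0\<close> has no lower neighbour
    as p^2 does not divide it, and all higher indices are multiples of \<open>p\<close>, with
    diagonal entry \<open>e 0\<close>.\<close>
  have tower: "(T ^^ r) a (n0 * (p\<^sup>2) ^ j) =
      (tridiag (e n0) (e 0) D ^^ r) (\<lambda>j. a (n0 * (p\<^sup>2) ^ j)) j" for r j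
  proof (induction r arbitrary: j)
    case (Suc r)
    have "(T ^^ Suc r) a (n0 * (p\<^sup>2) ^ j) =
        tridiag (e n0) (e 0) D (\<lambda>j. (T ^^ r) a (n0 * (p\<^sup>2) ^ j)) j"
    proof (cases j)
      case 0
      then show ?thesis using n0 by (simp add: tridiag_def T D_def mult_ac)
    next
      case (Suc i)
      have eq: "n0 * (p\<^sup>2) ^ j = p\<^sup>2 * (n0 * (p\<^sup>2) ^ i)" by (simp add: Suc)
      have dvd: "p\<^sup>2 dvd n0 * (p\<^sup>2) ^ j" unfolding eq by (rule dvd_triv_left)
      then have "p dvd n0 * (p\<^sup>2) ^ j" by (metis dvd_mult_left power2_eq_square)
      then have e': "e (n0 * (p\<^sup>2) ^ j) = e 0" by (rule e0)
      have div: "n0 * (p\<^sup>2) ^ j div p\<^sup>2 = n0 * (p\<^sup>2) ^ i"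
        unfolding eq using p_pos by (intro nonzero_mult_div_cancel_left) simp
      have up: "p\<^sup>2 * (n0 * (p\<^sup>2) ^ j) = n0 * (p\<^sup>2) ^ Suc j" by simp
      have "(T ^^ Suc r) a (n0 * (p\<^sup>2) ^ j) = (T ^^ r) a (n0 * (p\<^sup>2) ^ i)
          + e 0 * (T ^^ r) a (n0 * (p\<^sup>2) ^ j) + D * (T ^^ r) a (n0 * (p\<^sup>2) ^ Suc j)"
        unfolding funpow.simps o_def T div up e' D_def using dvd by (simp only: if_True)
      then show ?thesis by (simp add: tridiag_def Suc)
    qed
    then show ?case by (simp add: Suc)
  qed simp
  obtain E where E: "finite E" "E \<subseteq> upper_half_plane"
      "\<And>g z. g \<in> forms \<Longrightarrow> (\<And>e. e \<in> E \<Longrightarrow> g e = 0) \<Longrightarrow> z \<in> upper_half_plane \<Longrightarrow> g z = 0"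
    using forms_determined_by_finitely_many_values by blast
  \<comment> \<open>There are \<open>card E + 1\<close> iterates for \<open>card E\<close>
    points.\<close>
  obtain c r0 where c: "r0 \<le> card E" "c r0 \<noteq> 0"
      "\<And>u. u \<in> E \<Longrightarrow> (\<Sum>r\<le>card E. c r * (hecke ^^ r) f u) = 0"
    using nontrivial_vanishing_combination[OF E(1), of "{..card E}" "\<lambda>r. (hecke ^^ r) f"] by auto
  define g where "g = (\<lambda>z. \<Sum>r\<le>card E. c r * (hecke ^^ r) f z)"
  have "g \<in> forms" unfolding g_def by (intro forms_sum iter) auto
  then have "g z = 0" if "z \<in> upper_half_plane" for z
    using E(3)[of g z] c(3) that by (simp add: g_def)
  then have "has_q_expansion g (\<lambda>_. 0)"
    using has_q_expansion_cong[of g "\<lambda>_. 0"] has_q_expansion_zero by simp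
  moreover have "has_q_expansion g (\<lambda>n. \<Sum>r\<le>card E. c r * (T ^^ r) a n)"
    unfolding g_def by (intro has_q_expansion_sum has_q_expansion_cmult iter) auto
  ultimately have rel: "(\<Sum>r\<le>card E. c r * (T ^^ r) a n) = 0" for n
    using has_q_expansion_unique by (metis (no_types, lifting))
  have sp: "(1 / sqrt p) ^ W \<le> 1 / (p * sqrt p)"
  proof -
    have "(1 / sqrt p) ^ W \<le> (1 / sqrt p) ^ 3"
      using W p5 by (intro power_decreasing) (auto simp: field_simps)
    also have "\<dots> = 1 / (p * sqrt p)"
      using p5 by (simp add: power3_eq_cube)
    finally show ?thesis .
  qed
  show ?thesis
  proof (rule tridiag_annihilated_bounded_eq_0[where D = D and e = "e n0" and e' = "e 0" and c = c
        and x = "\<lambda>j. a (n0 * (p\<^sup>2) ^ j)", OF _ _ _ bd c(1,2)])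
    have "C \<noteq> 0" using C p_pos by (metis divide_eq_0_iff norm_zero of_nat_0_less_iff order_less_irrefl power_not_zero zero_neq_one)
    then show "D \<noteq> 0" using p_pos by (simp add: D_def)
    have "(1 / real p) ^ W \<le> (1 / real p) ^ 3"
      using W p5 by (intro power_decreasing) auto
    then have "norm D \<le> (real p)\<^sup>2 * (1 / real p) ^ 3"
      by (simp add: D_def norm_mult C norm_power mult_left_mono)
    also have "\<dots> = 1 / p" using p5 by (simp add: power2_eq_square power3_eq_cube)
    also have "\<dots> < 1" using p5 by simp
    finally show "norm D < 1" .
    have "norm (e n0 - e 0) \<le> norm (e n0) + norm (e 0)" by (rule norm_triangle_ineq4)
    also have "\<dots> \<le> 2 * ((real p - 1) * (1 / sqrt p) ^ W)" using e[of n0] e[of 0] by linarith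
    also have "\<dots> \<le> 2 * ((real p - 1) * (1 / (p * sqrt p)))"
      using sp p5 by (intro mult_left_mono) auto
    also have "\<dots> < 2 * (real p * (1 / (p * sqrt p)))"
      using p5 by (intro mult_strict_left_mono mult_strict_right_mono) auto
    also have "\<dots> = 2 / sqrt p" using p5 by simp
    also have "\<dots> < 1"
    proof -
      \<comment> \<open>This is where \<open>p\<close> at least 5 enters.\<close>
      have "2 < sqrt p" using p5 by (intro real_less_rsqrt) auto
      then show ?thesis using p5 by (subst divide_less_eq_1_pos) auto
    qed
    finally show "norm (e n0 - e 0) < 1" .
    show "(\<Sum>r\<le>card E. c r * (tridiag (e n0) (e 0) D ^^ r) (\<lambda>j. a (n0 * (p\<^sup>2) ^ j)) j) = 0" for j
      using rel[of "n0 * (p\<^sup>2) ^ j"] by (simp add: tower)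
  qed
qed

end

section \<open>The theta multiplier\<close>

text \<open>By Euler's theorem the value is a root of unity of order dividing
  \<open>totient N\<close>.\<close>

lemma dirichlet_character_norm:
  assumes "dirichlet_character N \<psi>" "N > 0" "coprime a (int N)"
  shows "norm (\<psi> a) = 1"
proof -
  have mult: "\<psi> (x * y) = \<psi> x * \<psi> y" and one: "\<psi> 1 = 1" for x y
    using assms by (auto simp: dirichlet_character_def)
  have pow: "\<psi> (a ^ n) = \<psi> a ^ n" for n
    by (induction n) (auto simp: mult one)
  define b where "b = nat (a mod int N)"
  have b: "int b = a mod int N" using assms(2) by (simp add: b_def)
  then have ab: "[int b = a] (mod int N)" by (simp add: cong_def)
  then have "coprime (int b) (int N)" using assms(3) cong_imp_coprime cong_sym by blast
  then have "coprime b N" by simp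
  then have "[b ^ totient N = 1] (mod N)" by (rule euler_theorem)
  then have "[int b ^ totient N = 1] (mod int N)"
    by (metis cong_int_iff of_nat_1 of_nat_power)
  moreover have "[a ^ totient N = int b ^ totient N] (mod int N)"
    using ab by (intro cong_pow) (rule cong_sym)
  ultimately have "[a ^ totient N = 1] (mod int N)" by (rule cong_trans[rotated])
  then have "\<psi> (a ^ totient N) = \<psi> 1"
    using assms(1) unfolding dirichlet_character_def by blast
  then have "norm (\<psi> a) ^ totient N = 1"
    by (simp add: pow one flip: norm_power)
  then show ?thesis
    using power_eq_imp_eq_base[of "norm (\<psi> a)" "totient N" 1] assms(2) by simp
qed

section \<open>Square factors in the quadratic symbol\<close>

lemma Legendre_mult_square:
  assumes "prime q" "\<not> q dvd x"
  shows "Legendre (c * x\<^sup>2) q = Legendre c q"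
proof -
  have cop: "coprime x q" using assms by (metis coprime_commute prime_imp_coprime)
  have "[c * x\<^sup>2 = 0] (mod q) \<longleftrightarrow> [c = 0] (mod q)"
    using assms by (auto simp: cong_0_iff prime_dvd_mult_iff prime_dvd_power_iff)
  moreover have "QuadRes q (c * x\<^sup>2) \<longleftrightarrow> QuadRes q c"
  proof
    assume "QuadRes q c"
    then obtain y where "[y\<^sup>2 = c] (mod q)" by (auto simp: QuadRes_def)
    then have "[(y * x)\<^sup>2 = c * x\<^sup>2] (mod q)" by (simp add: power_mult_distrib cong_scalar_right)
    then show "QuadRes q (c * x\<^sup>2)" by (auto simp: QuadRes_def)
  next
    assume "QuadRes q (c * x\<^sup>2)"
    then obtain y where y: "[y\<^sup>2 = c * x\<^sup>2] (mod q)" by (auto simp: QuadRes_def)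
    obtain u where u: "[x * u = 1] (mod q)" using cong_solve_coprime_int[OF cop] by blast
    have "[(y * u)\<^sup>2 = (c * x\<^sup>2) * u\<^sup>2] (mod q)"
      using y by (simp add: power_mult_distrib cong_scalar_right)
    also have "(c * x\<^sup>2) * u\<^sup>2 = c * (x * u)\<^sup>2" by (simp add: power_mult_distrib)
    also have "[c * (x * u)\<^sup>2 = c * 1\<^sup>2] (mod q)"
      using u by (intro cong_scalar_left cong_pow)
    finally show "QuadRes q c" by (auto simp: QuadRes_def)
  qed
  ultimately show ?thesis by (simp add: Legendre_def)
qed

text \<open>With x = p this supplies \<open>nu_conj\<close>. Neither the Legendre symbols at primes
  dividing d nor the sign of c, which governs the correction for negative d, change.\<close>

lemma quad_symbol_mult_square:
  assumes "coprime (c * x\<^sup>2) d" "x \<noteq> 0"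
  shows "quad_symbol (c * x\<^sup>2) d = quad_symbol c d"
proof -
  have "Legendre (c * x\<^sup>2) q = Legendre c q" if "q \<in># prime_factorization d" for q
  proof (rule Legendre_mult_square)
    show q: "prime q" using that by (simp add: in_prime_factors_iff)
    have "q dvd d" using that by (simp add: in_prime_factors_iff)
    show "\<not> q dvd x"
    proof
      assume "q dvd x"
      then have "q dvd c * x\<^sup>2" by (simp add: power2_eq_square)
      then have "is_unit q" using assms(1) \<open>q dvd d\<close> coprime_common_divisor by blast
      then show False using q not_prime_unit by blast
    qed
  qed
  then have "image_mset (Legendre (c * x\<^sup>2)) (prime_factorization d)
      = image_mset (Legendre c) (prime_factorization d)"
    by (intro image_mset_cong) auto
  moreover have "c * x\<^sup>2 < 0 \<longleftrightarrow> c < 0"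
    using assms(2) by (simp add: mult_less_0_iff)
  ultimately show ?thesis by (simp add: quad_symbol_def)
qed

lemma quad_symbol_sq:
  assumes "coprime c d" "odd d"
  shows "(quad_symbol c d)\<^sup>2 = 1"
proof -
  have "(\<Prod>q\<in>#A. Legendre c q)\<^sup>2 = 1" if "\<And>q. q \<in># A \<Longrightarrow> (Legendre c q)\<^sup>2 = 1" for A
    using that by (induction A) (auto simp: power_mult_distrib)
  moreover have "(Legendre c q)\<^sup>2 = 1" if "q \<in># prime_factorization d" for q
  proof -
    have "q dvd d" "\<not> is_unit q" using that by (auto simp: in_prime_factors_iff)
    then have "\<not> q dvd c" using assms(1) coprime_common_divisor by blast
    then show ?thesis by (simp add: Legendre_def cong_0_iff)
  qed
  ultimately have "(\<Prod>q\<in>#prime_factorization d. Legendre c q)\<^sup>2 = 1" by blast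
  then show ?thesis using assms(2) by (simp add: quad_symbol_def power_mult_distrib)
qed

lemma norm_theta_eps: "norm (theta_eps d) = 1"
  by (simp add: theta_eps_def)

theorem theoremA:
  fixes k N d :: nat
    and \<psi> :: "int \<Rightarrow> complex"
    and f :: "complex \<Rightarrow> complex"
    and a :: "nat \<Rightarrow> complex"
  assumes "k \<ge> 1"
    and "N > 0" and "4 dvd N"
    and "dirichlet_character N \<psi>" and "\<psi> (-1) = 1"
    and "f \<in> cusp_form_half k N \<psi>"
    and "\<forall>z\<in>upper_half_plane. ((\<lambda>n. a n * qpar z ^ n) has_sum f z) {1..}"
    and "k = 1 \<longrightarrow> f \<in> cusp_form_three_half_star N \<psi>"
    and "d > 0" and "squarefree d"
    and "\<forall>p. prime p \<and> p dvd N \<and> \<not> p dvd conductor (d * N) (twisted_character k \<psi> d)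
           \<longrightarrow> eigenform_Tp2 k \<psi> p f"
    and "\<exists>P>0. \<forall>n\<ge>1. a ((n + P)\<^sup>2 * d) = a (n\<^sup>2 * d)"
  shows "\<forall>n\<ge>1. a (n\<^sup>2 * d) = 0"
proof -
  define W where "W = 2 * k + 1"
  \<comment> \<open>The automorphy factor without its power of the square root, which
    \<open>J\<close> supplies.\<close>
  define \<nu> where "\<nu> = (\<lambda>c d. \<psi> d * (inverse (theta_eps d) * of_int (quad_symbol c d)) ^ W)"
  \<comment> \<open>The given expansion runs over n >= 1 and leaves \<open>a 0\<close> arbitrary,
    whereas \<open>has_q_expansion\<close> sums over all n.\<close>
  define a' where "a' = (\<lambda>n. if n = 0 then 0 else a n)"
  have odd: "odd e" if "coprime c e" "int N dvd c" for c e :: int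
  proof
    assume "even e"
    moreover have "even c"
      using that(2) \<open>4 dvd N\<close> by (metis dvd_trans even_numeral even_of_nat)
    ultimately show False using that(1) coprime_common_divisor[of c e 2] by simp
  qed
  have copN: "coprime e (int N)" if "coprime c e" "int N dvd c" for c e :: int
    using that by (metis coprime_commute coprime_divisors dvd_refl)
  interpret multiplier N W \<nu>
  proof
    show "N > 0" "W > 0" using assms by (auto simp: W_def)
    show "norm (\<nu> c e) = 1" if ce: "coprime c e" "int N dvd c" for c e
    proof -
      have "\<bar>quad_symbol c e\<bar> = 1"
        using quad_symbol_sq[OF ce(1) odd[OF ce]] by (auto simp: power2_eq_1_iff)
      then have "norm (of_int (quad_symbol c e) :: complex) = 1"
        by (metis norm_of_int of_int_1 of_int_abs)
      then show ?thesis
        using dirichlet_character_norm[OF assms(4,2) copN[OF ce]]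
        by (simp add: \<nu>_def norm_mult norm_power norm_inverse norm_theta_eps)
    qed
    show "(\<nu> c e)\<^sup>2 = 1" if ce: "coprime c e" "int N dvd c" "int N dvd e - 1" for c e
    proof -
      have "[e = 1] (mod int N)" using ce(3) by (simp add: cong_iff_dvd_diff)
      then have "\<psi> e = \<psi> 1" using assms(4) unfolding dirichlet_character_def by blast
      then have "\<psi> e = 1" using assms(4) unfolding dirichlet_character_def by simp
      moreover have "[e = 1] (mod 4)"
        using ce(3) \<open>4 dvd N\<close> by (metis cong_iff_dvd_diff dvd_trans int_dvd_int_iff of_nat_numeral)
      moreover have "(of_int (quad_symbol c e) :: complex)\<^sup>2 = 1"
        using quad_symbol_sq[OF ce(1) odd[OF ce(1,2)]] by (metis of_int_1 of_int_power)
      ultimately show ?thesis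
        by (simp add: \<nu>_def theta_eps_def mult.commute[of W] flip: power_mult) (simp add: power_mult)
    qed
    show "\<nu> 0 1 = 1"
      using assms(4) by (simp add: \<nu>_def theta_eps_def quad_symbol_def dirichlet_character_def)
  qed
  have J: "J (x, y, c, e) z = \<psi> e * theta_factor c e z ^ (2 * k + 1)" for x y c e z
    unfolding J.simps by (simp add: \<nu>_def theta_factor_def W_def power_mult_distrib mult_ac)
  have hol: "f holomorphic_on upper_half_plane"
    using assms(6) by (simp add: cusp_form_half_def)
  have mod: "f (act \<gamma> z) = J \<gamma> z * f z" if "\<gamma> \<in> Gamma0 N" "z \<in> upper_half_plane" for \<gamma> z
    using assms(6) that unfolding cusp_form_half_def Gamma0_def by (auto simp: J simp del: J.simps)
  have "vanishes_at_cusps (\<lambda>c d z. csqrt (of_int c * z + of_int d) ^ W) f"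
    using assms(6) by (simp add: cusp_form_half_def W_def)
  then obtain S where "\<And>z. z \<in> upper_half_plane \<Longrightarrow> norm (f z) * wt z \<le> S"
    using cusp_form_bounded[OF mod] by blast
  then have f: "f \<in> forms" using hol mod unfolding forms_def by blast
  have a': "has_q_expansion f a'"
    unfolding has_q_expansion_def
  proof
    fix z assume "z \<in> upper_half_plane"
    then have "((\<lambda>n. a n * qpar z ^ n) has_sum f z) {1..}" using assms(7) by blast
    then show "((\<lambda>n. a' n * qpar z ^ n) has_sum f z) UNIV"
      by (rule has_sum_cong_neutral[THEN iffD1, rotated -1]) (auto simp: a'_def)
  qed
  obtain P where P: "P > 0" "\<And>n. n \<ge> 1 \<Longrightarrow> a ((n + P)\<^sup>2 * d) = a (n\<^sup>2 * d)"
    using assms(12) by blast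
  \<comment> \<open>The sum over one period bounds every coefficient of the block, after subtracting
    the period repeatedly.\<close>
  define Bd where "Bd = (\<Sum>n\<in>{1..P}. norm (a (n\<^sup>2 * d)))"
  have bd: "norm (a (n\<^sup>2 * d)) \<le> Bd" if "n \<ge> 1" for n
    using that
  proof (induction n rule: less_induct)
    case (less n)
    show ?case
    proof (cases "n \<le> P")
      case True
      then show ?thesis
        unfolding Bd_def using less by (intro member_le_sum) auto
    next
      case False
      then have "a (n\<^sup>2 * d) = a ((n - P)\<^sup>2 * d)" using P(2)[of "n - P"] by simp
      then show ?thesis using less.IH[of "n - P"] False P(1) by simp
    qed
  qed
  show ?thesis
  \<comment> \<open>The cocycle relation is deduced from a point where \<open>f\<close> does not
    vanish.\<close>
  proof (cases "\<forall>z\<in>upper_half_plane. f z = 0")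
    case True
    then have "has_q_expansion f (\<lambda>_. 0)"
      using has_q_expansion_cong[of f "\<lambda>_. 0"] has_q_expansion_zero by simp
    then have "a' = (\<lambda>_. 0)" using a' has_q_expansion_unique by blast
    moreover have "a' (n\<^sup>2 * d) = a (n\<^sup>2 * d)" if "n \<ge> 1" for n
      using that \<open>d > 0\<close> by (simp add: a'_def)
    ultimately show ?thesis by metis
  next
    case False
    then obtain z1 where z1: "z1 \<in> upper_half_plane" "f z1 \<noteq> 0" by blast
    \<comment> \<open>Being larger than N, d and 5, this prime divides neither N nor d and serves
      for all n at once.\<close>
    obtain p where pr: "prime p" "p > N * d + 5" using bigger_prime by blast
    have pN: "\<not> p dvd N" "\<not> p dvd d"
    proof -
      have "N \<le> N * d" "d \<le> N * d" using \<open>d > 0\<close> \<open>N > 0\<close> by auto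
      then have "N < p" "d < p" using pr(2) by linarith+
      then show "\<not> p dvd N" "\<not> p dvd d"
        using \<open>d > 0\<close> \<open>N > 0\<close> by (auto dest: nat_dvd_not_less)
    qed
    have "coprime (int p) (int N)"
      using pr(1) pN(1) by (intro prime_imp_coprime) auto
    then have "coprime ((int p)\<^sup>2) (int N)" by simp
    then obtain u v where uv: "u * (int p)\<^sup>2 + v * int N = 1"
      by (metis bezout_int coprime_iff_gcd_eq_1)
    interpret hecke_data N W \<nu> p u "- v"
    proof
      show "prime p" "u * (int p)\<^sup>2 - (- v) * int N = 1" using pr uv by auto
      show "\<nu> (c * (int p)\<^sup>2) e = \<nu> c e" if "coprime (c * (int p)\<^sup>2) e" for c e
        using quad_symbol_mult_square[OF that] pr(1) by (auto simp: \<nu>_def)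
      show "J (mmul \<gamma> \<delta>) z = J \<gamma> (act \<delta> z) * J \<delta> z"
        if "\<gamma> \<in> Gamma0 N" "\<delta> \<in> Gamma0 N" "z \<in> upper_half_plane" for \<gamma> \<delta> z
        by (rule cocycle_of_nonzero_form[OF hol _ z1]) (fact mod that)+
    qed
    show ?thesis
    proof (intro allI impI)
      fix n :: nat assume n: "n \<ge> 1"
      \<comment> \<open>With n = p^s m, the index n^2 d is the entry s of the tower over m^2 d, and
        p^2 does not divide m^2 d.\<close>
      obtain s m where m: "n = p ^ s * m" "\<not> p dvd m"
        using multiplicity_decompose'[of n p] pr(1) n by (metis less_one not_le not_prime_unit)
      have "m \<ge> 1" using m n by (cases m) auto
      define n0 where "n0 = m\<^sup>2 * d"
      have n0: "n0 * (p\<^sup>2) ^ j = (p ^ j * m)\<^sup>2 * d" for j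
        by (simp add: n0_def power_mult_distrib flip: power_mult) (simp add: mult_ac)
      have a'_n0: "a' (n0 * (p\<^sup>2) ^ j) = a ((p ^ j * m)\<^sup>2 * d)" for j
        unfolding n0 using \<open>m \<ge> 1\<close> \<open>d > 0\<close> p_pos by (auto simp: a'_def)
      have "a' (n0 * (p\<^sup>2) ^ s) = 0"
      proof (rule bounded_p_tower_eq_0[OF f a'])
        show "W \<ge> 3" using assms(1) by (simp add: W_def)
        show "p \<ge> 5" using pr by simp
        show "\<not> p\<^sup>2 dvd n0"
        proof
          assume "p\<^sup>2 dvd n0"
          then have "p dvd n0" by (metis dvd_mult_left power2_eq_square)
          then show False
            using m(2) pN(2) pr(1) by (simp add: n0_def prime_dvd_mult_iff prime_dvd_power_iff)
        qed
        show "norm (a' (n0 * (p\<^sup>2) ^ j)) \<le> Bd" for j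
          unfolding a'_n0 using \<open>m \<ge> 1\<close> p_pos by (intro bd) (simp add: Suc_le_eq)
      qed
      then show "a (n\<^sup>2 * d) = 0" by (simp only: a'_n0 m(1))
    qed
  qed
qed

end
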